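(* Let $g\ge1$, $\Gamma\subset\mathrm{Sp}_{2g}(\mathbb Z)$ a congruence subgroup, $\mathcal A$ a finite-dimensional complex algebra, $e\in\mathbb C\setminus\{0\}$, and $A:\mathbb H_g\to\mathrm{Sym}_g(\mathbb C)$ meromorphic symmetric-matrix-valued with $$A(\gamma\cdot Z)=J(\gamma,Z)A(Z)J(\gamma,Z)^t+\frac{2e}{2\pi i}J(\gamma,Z)C^t\qquad\text{for all }\gamma=\begin{pmatrix}A_\gamma&B\\C&D\end{pmatrix}\in\Gamma.$$ For $\Phi\in\mathcal M_{k,m}(\Gamma;\mathcal A)$ define $D_A\Phi(Z)[u]:=\mathcal D_{\mathrm{raw}}(\Phi)(Z)[u]-\frac{k+m}{2e}\,(u^tA(Z)u)\,\Phi(Z)[u]$. Then $D_A\Phi\in\mathcal M_{k,m+2}(\Gamma;\mathcal A)$; equivalently, $D_A$ maps $\mathcal M_{k,m}(\Gamma;\mathcal A)$ into $\mathcal M_{k,m+2}(\Gamma;\mathcal A)$.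
   Context: $\mathbb H_g=\{Z\in\mathrm{Mat}_g(\mathbb C):Z^t=Z,\ \mathrm{Im}Z>0\}$, $\gamma\cdot Z=(A_\gamma Z+B)(CZ+D)^{-1}$, $J(\gamma,Z)=CZ+D$. $\mathrm{Sym}^m(\mathbb C^g)$ is identified with homogeneous degree-$m$ polynomials in a formal vector $u=(u_1,\dots,u_g)^t$. $\mathcal M_{k,m}(\Gamma;\mathcal A)$: meromorphic $\Phi:\mathbb H_g\to\mathrm{Sym}^m(\mathbb C^g)\otimes\mathcal A$ with $\Phi(\gamma\cdot Z)[u]=\det(J(\gamma,Z))^k\Phi(Z)[J(\gamma,Z)^tu]$ for $\gamma\in\Gamma$. $D=\frac1{2\pi i}\frac{\partial}{\partial Z}$ is the symmetric matrix of operators with diagonal entries $\frac1{2\pi i}\partial/\partial Z_{ii}$ and off-diagonal entries $\frac1{2\pi i}\cdot\frac12\partial/\partial Z_{ij}$, applied coefficientwise; $\mathcal D_{\mathrm{raw}}(\Phi)(Z)[u]:=\sum_{i,j}u_iu_j(D\Phi)_{ij}(Z)[u]$. *)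

theory Defs
  imports "HOL-Analysis.Analysis"
begin

definition cscale :: "complex \<Rightarrow> complex^'g::finite^'h::finite \<Rightarrow> complex^'g^'h" where
  "cscale c M = (\<chi> i j. c * M$i$j)"

definition sym_part :: "complex^'g::finite^'g \<Rightarrow> complex^'g^'g" where
  "sym_part Z = (\<chi> i j. (Z$i$j + Z$j$i) / 2)"

definition siegel_H :: "(complex^'g::finite^'g) set" where
  "siegel_H = {Z. transpose Z = Z \<and>
     (\<forall>x::real^'g. x \<noteq> 0 \<longrightarrow> x \<bullet> ((\<chi> i j. Im (Z$i$j)) *v x) > 0)}"

text \<open>Holomorphy on a (relatively open) subset V of the symmetric matrices:
  the composite with the symmetrisation projection is complex-Frechet-differentiable
  on the open preimage of V.\<close>
definition holo_on :: "(complex^'g::finite^'g \<Rightarrow> complex) \<Rightarrow> (complex^'g^'g) set \<Rightarrow> bool" where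
  "holo_on h V \<longleftrightarrow> (\<forall>z \<in> sym_part -` V. \<exists>L. ((h \<circ> sym_part) has_derivative L) (at z) \<and>
        (\<forall>c x. L (cscale c x) = c * L x))"

text \<open>Meromorphic on the Siegel upper half space: locally a quotient of holomorphic
  functions with denominator not identically zero (values at points where the
  denominator vanishes are unconstrained).\<close>
definition mero_on_H :: "(complex^'g::finite^'g \<Rightarrow> complex) \<Rightarrow> bool" where
  "mero_on_H f \<longleftrightarrow> (\<forall>Z0\<in>siegel_H. \<exists>V h q. Z0 \<in> V \<and> V \<subseteq> siegel_H \<and> open (sym_part -` V) \<and>
      connected V \<and> holo_on h V \<and> holo_on q V \<and> (\<exists>z\<in>V. q z \<noteq> 0) \<and>
      (\<forall>z\<in>V. q z \<noteq> 0 \<longrightarrow> f z = h z / q z))"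

text \<open>Equality as meromorphic functions: equality on a dense relatively open subset.\<close>
definition ae_eq_H :: "(complex^'g::finite^'g \<Rightarrow> 'b) \<Rightarrow> (complex^'g^'g \<Rightarrow> 'b) \<Rightarrow> bool" where
  "ae_eq_H f g \<longleftrightarrow> (\<exists>V. V \<subseteq> siegel_H \<and> open (sym_part -` V) \<and> siegel_H \<subseteq> closure V \<and>
      (\<forall>Z\<in>V. f Z = g Z))"

definition Jsympl :: "int^('g::finite+'g)^('g+'g)" where
  "Jsympl = (\<chi> a b. case (a, b) of
      (Inl i, Inr j) \<Rightarrow> (if i = j then 1 else 0)
    | (Inr i, Inl j) \<Rightarrow> (if i = j then -1 else 0)
    | _ \<Rightarrow> 0)"

definition Sp :: "(int^('g::finite+'g)^('g+'g)) set" where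
  "Sp = {M. transpose M ** Jsympl ** M = Jsympl}"

definition principal_cong :: "nat \<Rightarrow> (int^('g::finite+'g)^('g+'g)) set" where
  "principal_cong N = {M \<in> Sp. \<forall>a b. int N dvd (M$a$b - mat 1 $a$b)}"

definition congruence_subgroup :: "(int^('g::finite+'g)^('g+'g)) set \<Rightarrow> bool" where
  "congruence_subgroup \<Gamma> \<longleftrightarrow> \<Gamma> \<subseteq> Sp \<and> mat 1 \<in> \<Gamma> \<and>
     (\<forall>M\<in>\<Gamma>. \<forall>M'\<in>\<Gamma>. M ** M' \<in> \<Gamma>) \<and>
     (\<forall>M\<in>\<Gamma>. \<exists>M'\<in>\<Gamma>. M ** M' = mat 1 \<and> M' ** M = mat 1) \<and>
     (\<exists>N>0. principal_cong N \<subseteq> \<Gamma>)"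

definition blkA :: "int^('g::finite+'g)^('g+'g) \<Rightarrow> complex^'g^'g" where
  "blkA \<gamma> = (\<chi> i j. of_int (\<gamma> $ Inl i $ Inl j))"
definition blkB :: "int^('g::finite+'g)^('g+'g) \<Rightarrow> complex^'g^'g" where
  "blkB \<gamma> = (\<chi> i j. of_int (\<gamma> $ Inl i $ Inr j))"
definition blkC :: "int^('g::finite+'g)^('g+'g) \<Rightarrow> complex^'g^'g" where
  "blkC \<gamma> = (\<chi> i j. of_int (\<gamma> $ Inr i $ Inl j))"
definition blkD :: "int^('g::finite+'g)^('g+'g) \<Rightarrow> complex^'g^'g" where
  "blkD \<gamma> = (\<chi> i j. of_int (\<gamma> $ Inr i $ Inr j))"

definition autom_J :: "int^('g::finite+'g)^('g+'g) \<Rightarrow> complex^'g^'g \<Rightarrow> complex^'g^'g" where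
  "autom_J \<gamma> Z = blkC \<gamma> ** Z + blkD \<gamma>"

definition act :: "int^('g::finite+'g)^('g+'g) \<Rightarrow> complex^'g^'g \<Rightarrow> complex^'g^'g" where
  "act \<gamma> Z = (blkA \<gamma> ** Z + blkB \<gamma>) ** matrix_inv (autom_J \<gamma> Z)"

definition fd_complex_algebra :: "(complex^'n::finite \<Rightarrow> complex^'n \<Rightarrow> complex^'n) \<Rightarrow> bool" where
  "fd_complex_algebra mul \<longleftrightarrow>
     (\<forall>a b c. mul (a + b) c = mul a c + mul b c \<and> mul a (b + c) = mul a b + mul a c) \<and>
     (\<forall>s a b. mul (s *s a) b = s *s mul a b \<and> mul a (s *s b) = s *s mul a b) \<and>
     (\<forall>a b c. mul (mul a b) c = mul a (mul b c)) \<and>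
     (\<exists>one. \<forall>a. mul one a = a \<and> mul a one = a)"

definition monoms :: "nat \<Rightarrow> ('g::finite \<Rightarrow> nat) set" where
  "monoms m = {\<alpha>. (\<Sum>i\<in>UNIV. \<alpha> i) = m}"

definition polyev :: "nat \<Rightarrow> (('g::finite \<Rightarrow> nat) \<Rightarrow> complex^'n) \<Rightarrow> complex^'g \<Rightarrow> complex^'n" where
  "polyev m c u = (\<Sum>\<alpha>\<in>monoms m. (\<Prod>i\<in>UNIV. u$i ^ \<alpha> i) *s c \<alpha>)"

definition mform :: "(int^('g::finite+'g)^('g+'g)) set \<Rightarrow> int \<Rightarrow> nat \<Rightarrow>
    (complex^'g^'g \<Rightarrow> complex^'g \<Rightarrow> complex^'n::finite) \<Rightarrow> bool" where
  "mform \<Gamma> k m \<Phi> \<longleftrightarrow>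
     (\<exists>c. (\<forall>\<alpha>\<in>monoms m. \<forall>j. mero_on_H (\<lambda>Z. c Z \<alpha> $ j)) \<and> ae_eq_H \<Phi> (\<lambda>Z. polyev m (c Z))) \<and>
     (\<forall>\<gamma>\<in>\<Gamma>. ae_eq_H (\<lambda>Z. \<Phi> (act \<gamma> Z))
        (\<lambda>Z u. (det (autom_J \<gamma> Z) powi k) *s \<Phi> Z (transpose (autom_J \<gamma> Z) *v u)))"

text \<open>Direction in Sym_g giving d/dZ_ii on the diagonal and (1/2) d/dZ_ij off it.\<close>
definition dirmat :: "'g::finite \<Rightarrow> 'g \<Rightarrow> complex^'g^'g" where
  "dirmat i j = (\<chi> a b. (if a = i \<and> b = j then 1/2 else 0) + (if a = j \<and> b = i then 1/2 else 0))"

definition pderiv_dir :: "(complex^'g::finite^'g \<Rightarrow> complex^'n) \<Rightarrow> complex^'g^'g \<Rightarrow> complex^'g^'g \<Rightarrow> complex^'n" where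
  "pderiv_dir F Z S = (\<chi> l. deriv (\<lambda>t. F (Z + cscale t S) $ l) 0)"

definition D_raw :: "(complex^'g::finite^'g \<Rightarrow> complex^'g \<Rightarrow> complex^'n) \<Rightarrow> complex^'g^'g \<Rightarrow> complex^'g \<Rightarrow> complex^'n" where
  "D_raw \<Phi> Z u = (\<Sum>i\<in>UNIV. \<Sum>j\<in>UNIV.
       (u$i * u$j) *s ((1 / (2 * pi * \<i>)) *s pderiv_dir (\<lambda>W. \<Phi> W u) Z (dirmat i j)))"

definition D_A :: "(complex^'g::finite^'g \<Rightarrow> complex^'g^'g) \<Rightarrow> complex \<Rightarrow> int \<Rightarrow> nat \<Rightarrow>
    (complex^'g^'g \<Rightarrow> complex^'g \<Rightarrow> complex^'n) \<Rightarrow> complex^'g^'g \<Rightarrow> complex^'g \<Rightarrow> complex^'n" where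
  "D_A A e k m \<Phi> Z u = D_raw \<Phi> Z u -
     ((of_int k + of_nat m) / (2 * e) * (\<Sum>i\<in>UNIV. \<Sum>j\<in>UNIV. u$i * A Z $i$j * u$j)) *s \<Phi> Z u"

end

(* For v = J^t u the action maps the line Z + t v v^t to the line gamma Z + s u u^t, with
   s = t / (1 + t kappa) and kappa = u^t C v, and along it det J and J^t u are both multiplied by
   1 + t kappa. Restricted to this line, the transformation law of Phi reads
   Phi(gamma Z + s u u^t)[u] = det(J)^k (1 + t kappa)^(k+m) Phi(Z + t v v^t)[v].
   Its t-derivative at 0 is the transformation law of D_raw Phi, since D_raw Phi(Z)[u] is the
   derivative of Phi(.)[u] in the direction u u^t; the defect (k+m) kappa is cancelled by the
   inhomogeneous term in the law of A.
   Meromorphy of the new coefficients rests on two facts about several complex variables: a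
   directional derivative of a holomorphic function is holomorphic (differentiation under
   Cauchy's integral), and a nonzero holomorphic function on a connected set is nonzero on a
   dense subset (continuation along complex lines). *)

theory Submission
  imports Defs "HOL-Complex_Analysis.Conformal_Mappings"
begin

subsection \<open>Rank-one matrices and matrix inverses\<close>

text \<open>\<open>mero_on_H\<close> leaves the values on the zero set of a denominator free, and
  the laws of \<open>\<Phi>\<close> and \<open>A\<close> hold only on dense relatively open sets,
  whereas \<open>D_raw\<close> applies \<open>deriv\<close> to actual values. The argument therefore
  runs at points having a neighbourhood on which \<open>\<Phi>\<close> is a polynomial with
  holomorphic coefficients and obeys its law: there the law may be differentiated. The image point
  must be regular too, so preimages of dense open sets under the action have to be dense, which is
  where inverses in \<open>\<Gamma>\<close> enter. Symmetric matrices form a proper subspace of the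
  matrix type when g > 1; analysis is done for functions composed with \<open>sym_part\<close> on
  truly open sets and read off along symmetric directions. In k + m, the k is the exponent of the
  determinant and the m is the degree of homogeneity. As the vector argument stays a multiple of v
  along the line, homogeneity replaces any derivative in that argument. The 2e in the law of
  \<open>A\<close> cancels the 2e in the definition of \<open>D_A\<close>, leaving (k+m) \<kappa> /
  (2 pi i).\<close>

definition outer :: "'a::semiring_1^'n \<Rightarrow> 'a^'m \<Rightarrow> 'a^'m^'n" where
  "outer a b = (\<chi> i j. a$i * b$j)"

text \<open>Bilinear, without conjugation: it is the product of a row and a column in expressions
  such as u^t C v. Hermitian forms are obtained by inserting \<open>cnjv\<close>.\<close>

definition cdot :: "complex^'n \<Rightarrow> complex^'n \<Rightarrow> complex" where
  "cdot v w = (\<Sum>i\<in>UNIV. v$i * w$i)"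

lemma cdot_commute: "cdot v w = cdot w v"
  by (simp add: cdot_def mult.commute)

lemma cdot_add_right: "cdot v (w + w') = cdot v w + cdot v w'"
  by (simp add: cdot_def distrib_left sum.distrib)

lemma cdot_add_left: "cdot (w + w') v = cdot w v + cdot w' v"
  by (simp add: cdot_def distrib_right sum.distrib)

lemma cdot_diff_right: "cdot v (w - w') = cdot v w - cdot v w'"
  by (simp add: cdot_def right_diff_distrib sum_subtractf)

lemma cdot_scale: "cdot (t *s v) w = t * cdot v w" "cdot v (t *s w) = t * cdot v w"
  by (simp_all add: cdot_def sum_distrib_left mult_ac)

lemma cdot_matrix: "cdot (M *v v) w = cdot v (transpose M *v w)"
proof -
  have "cdot (M *v v) w = (\<Sum>i\<in>UNIV. \<Sum>j\<in>UNIV. M$i$j * v$j * w$i)"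
    by (simp add: cdot_def matrix_vector_mult_def sum_distrib_right)
  also have "\<dots> = (\<Sum>j\<in>UNIV. \<Sum>i\<in>UNIV. M$i$j * v$j * w$i)"
    by (rule sum.swap)
  finally show ?thesis
    by (simp add: cdot_def matrix_vector_mult_def transpose_def sum_distrib_left mult_ac
        del: transpose_matrix_vector)
qed

lemma transpose_outer: "transpose (outer a b) = outer b (a :: complex^'n)"
  by (simp add: transpose_def outer_def vec_eq_iff mult.commute)

lemma matrix_mul_outer: "M ** outer a b = outer (M *v a) (b :: complex^'n)"
  by (simp add: outer_def matrix_matrix_mult_def matrix_vector_mult_def vec_eq_iff
      sum_distrib_right mult.assoc)

lemma outer_mul_matrix: "outer a b ** M = outer a (transpose M *v (b :: complex^'n))"
  by (simp add: outer_def matrix_matrix_mult_def matrix_vector_mult_def transpose_def vec_eq_iff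
      sum_distrib_left mult_ac del: transpose_matrix_vector)

lemma outer_vector: "outer a b *v c = cdot b c *s (a :: complex^'n)"
  by (simp add: outer_def matrix_vector_mult_def cdot_def vec_eq_iff
      sum_distrib_left sum_distrib_right mult_ac)

lemma cscale_outer: "cscale t (outer a b) = outer (t *s a) b"
  by (simp add: cscale_def outer_def vec_eq_iff mult_ac)

lemma outer_add_left: "outer (a + a') b = outer a b + outer (a' :: complex^'n) b"
  by (simp add: outer_def vec_eq_iff algebra_simps)

section \<open>Determinant of a rank-one perturbation of the identity\<close>

lemma det_replace_row_mat:
  fixes b :: "'a::field^'n"
  shows "det (\<chi> i. if i = x then b else mat 1 $ i) = b$x"
proof -
  have "(\<Sum>i\<in>UNIV. b$i *s row i (mat 1)) = b"
    by (simp add: vec_eq_iff row_def mat_def if_distrib[of "(*) _"] cong: if_cong)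
  moreover have "row i (mat 1) = (mat 1 :: 'a^'n^'n) $ i" for i
    by (simp add: row_def)
  ultimately show ?thesis
    using cramer_lemma_transpose[of x b "mat 1 :: 'a^'n^'n"] by (simp cong: if_cong)
qed

text \<open>Row \<open>x\<close> is \<open>b\<close> itself, so row operations clear every summand
  \<open>a i *s b\<close> and leave the identity with a single replaced row.\<close>

lemma det_replace_rows_add:
  fixes b :: "'a::field^'n"
  assumes "finite S" "x \<notin> S"
  shows "det (\<chi> i. if i = x then b else if i \<in> S then mat 1 $ i + a i *s b else mat 1 $ i) = b$x"
  using assms
proof (induction S rule: finite_induct)
  case empty
  then show ?case by (simp add: det_replace_row_mat cong: if_cong)
next
  case (insert y S)
  let ?M = "\<chi> i. if i = x then b else if i \<in> S then mat 1 $ i + a i *s b else mat 1 $ i"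
  have "(\<chi> i. if i = x then b else if i \<in> insert y S then mat 1 $ i + a i *s b else mat 1 $ i)
      = (\<chi> k. if k = y then row y ?M + a y *s row x ?M else row k ?M)"
    using insert.hyps insert.prems by (auto simp: vec_eq_iff row_def)
  then show ?case
    using insert det_row_operation[of y x ?M "a y"] by auto
qed

text \<open>Expanding by linearity in one modified row at a time, contributions with two rows
  proportional to \<open>b\<close> vanish, so only terms linear in \<open>a\<close> survive. The set
  \<open>S\<close> of rows already modified makes the induction possible.\<close>

lemma det_mat_plus_rows:
  fixes b :: "'a::field^'n"
  assumes "finite S"
  shows "det (\<chi> i. if i \<in> S then mat 1 $ i + a i *s b else mat 1 $ i) = 1 + (\<Sum>i\<in>S. a i * b$i)"
  using assms
proof (induction S rule: finite_induct)
  case empty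
  have "(\<chi> i. mat 1 $ i) = (mat 1 :: 'a^'n^'n)" by (simp add: vec_eq_iff)
  then show ?case by simp
next
  case (insert x S)
  let ?r = "\<lambda>i. if i \<in> S then mat 1 $ i + a i *s b else mat 1 $ i"
  have "(\<chi> i. if i \<in> insert x S then mat 1 $ i + a i *s b else mat 1 $ i)
      = (\<chi> i. if i = x then mat 1 $ i + a x *s b else ?r i)"
    by (simp add: vec_eq_iff)
  then have "det (\<chi> i. if i \<in> insert x S then mat 1 $ i + a i *s b else mat 1 $ i)
      = det (\<chi> i. if i = x then mat 1 $ i else ?r i) + a x * det (\<chi> i. if i = x then b else ?r i)"
    using det_row_add[of x "\<lambda>i. mat 1 $ i" "\<lambda>i. a x *s b" ?r]
      det_row_mul[of x "a x" "\<lambda>i. b" ?r] by simp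
  also have "(\<chi> i. if i = x then mat 1 $ i else ?r i) = (\<chi> i. ?r i)"
    using insert.hyps by (auto simp: vec_eq_iff)
  also have "det (\<chi> i. if i = x then b else ?r i) = b$x"
    by (rule det_replace_rows_add[OF insert.hyps])
  finally show ?case using insert by simp
qed

lemma det_mat_plus_outer:
  fixes a b :: "complex^'n"
  shows "det (mat 1 + outer a b) = 1 + cdot a b"
proof -
  have "mat 1 + outer a b = (\<chi> i. if i \<in> UNIV then mat 1 $ i + a$i *s b else mat 1 $ i)"
    by (simp add: vec_eq_iff outer_def)
  then show ?thesis
    using det_mat_plus_rows[of UNIV "\<lambda>i. a$i" b] by (simp add: cdot_def)
qed

lemma matrix_inv_right: "invertible M \<Longrightarrow> M ** matrix_inv M = mat 1"
  and matrix_inv_left: "invertible M \<Longrightarrow> matrix_inv M ** M = mat 1"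
  unfolding invertible_def matrix_inv_def by (metis (mono_tags, lifting) someI_ex)+

text \<open>Cramer's rule applied to a column of the inverse. It exhibits each entry as a quotient
  of determinants, from which continuity of inversion follows.\<close>

lemma matrix_inv_component:
  fixes M :: "complex^'n^'n"
  assumes "invertible M"
  shows "matrix_inv M $ k $ l = det (\<chi> i j. if j = k then mat 1 $ i $ l else M$i$j) / det M"
proof -
  let ?x = "\<chi> k. matrix_inv M $ k $ l" and ?b = "\<chi> i. (mat 1 $ i $ l :: complex)"
  have "M *v ?x = ?b"
    using matrix_inv_right[OF assms]
    by (simp add: vec_eq_iff matrix_vector_mult_def matrix_matrix_mult_def)
  then have "?x $ k = det (\<chi> i j. if j = k then ?b $ i else M$i$j) / det M"
    using cramer[of M ?x ?b] assms by (simp add: invertible_det_nz)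
  then show ?thesis by (simp cong: if_cong)
qed

lemma continuous_on_matrix_mult:
  fixes f :: "'t::topological_space \<Rightarrow> complex^'n^'m" and g :: "'t \<Rightarrow> complex^'l^'n"
  assumes "continuous_on S f" "continuous_on S g"
  shows "continuous_on S (\<lambda>x. f x ** g x)"
  unfolding matrix_matrix_mult_def
  by (intro continuous_intros assms continuous_on_vec_lambda)

lemma continuous_on_matrix_det:
  fixes f :: "'t::topological_space \<Rightarrow> complex^'n^'n"
  assumes "\<And>i j. continuous_on S (\<lambda>x. f x $ i $ j)"
  shows "continuous_on S (\<lambda>x. det (f x))"
  unfolding det_def by (intro continuous_intros assms)

lemma continuous_on_matrix_inv:
  fixes f :: "'t::topological_space \<Rightarrow> complex^'n^'n"
  assumes f: "continuous_on S f" and inv: "\<And>x. x \<in> S \<Longrightarrow> invertible (f x)"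
  shows "continuous_on S (\<lambda>x. matrix_inv (f x))"
proof -
  have cont: "continuous_on S (\<lambda>x. det (\<chi> i j. if j = k then mat 1 $ i $ l else f x $i$j) / det (f x))" for k l
  proof (intro continuous_on_divide continuous_on_matrix_det)
    show "continuous_on S (\<lambda>x. (\<chi> i j. if j = k then mat 1 $ i $ l else f x $ i $ j) $ i $ j)" for i j
      by (cases "j = k") (auto intro!: continuous_intros f)
  qed (use inv in \<open>auto intro!: continuous_intros f simp: invertible_det_nz\<close>)
  have "continuous_on S (\<lambda>x. matrix_inv (f x) $ k $ l)" for k l
    by (rule continuous_on_eq[OF cont[of k l]]) (simp add: matrix_inv_component inv)
  then have "continuous_on S (\<lambda>x. \<chi> k l. matrix_inv (f x) $ k $ l)"
    by (intro continuous_on_vec_lambda)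
  then show ?thesis by simp
qed

section \<open>Block relations of a symplectic matrix\<close>

lemma sum_UNIV_Plus:
  fixes f :: "'a::finite + 'b::finite \<Rightarrow> 'c::comm_monoid_add"
  shows "(\<Sum>x\<in>UNIV. f x) = (\<Sum>x\<in>UNIV. f (Inl x)) + (\<Sum>x\<in>UNIV. f (Inr x))"
  using sum.Plus[of "UNIV :: 'a set" "UNIV :: 'b set" f] by (simp add: UNIV_Plus_UNIV comp_def)

lemma Sp_relation:
  fixes M :: "int^('g::finite+'g)^('g+'g)"
  assumes "M \<in> Sp"
  shows "(\<Sum>k\<in>UNIV. M$Inl k$a * M$Inr k$b) - (\<Sum>k\<in>UNIV. M$Inr k$a * M$Inl k$b) = Jsympl$a$b"
proof -
  have "(\<Sum>y\<in>UNIV. (\<Sum>x\<in>UNIV. M$x$a * Jsympl$x$y) * M$y$b) = Jsympl$a$b"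
    using assms by (simp add: Sp_def vec_eq_iff matrix_matrix_mult_def transpose_def)
  then show ?thesis
    by (simp add: sum_UNIV_Plus Jsympl_def if_distrib[of "(*) _"] cong: if_cong)
      (simp add: sum_negf algebra_simps)
qed

lemma Sp_blocks:
  fixes M :: "int^('g::finite+'g)^('g+'g)"
  assumes "M \<in> Sp"
  shows "transpose (blkA M) ** blkC M = transpose (blkC M) ** blkA M"
    and "transpose (blkB M) ** blkD M = transpose (blkD M) ** blkB M"
    and "transpose (blkA M) ** blkD M - transpose (blkC M) ** blkB M = mat 1"
    and "transpose (blkD M) ** blkA M - transpose (blkB M) ** blkC M = mat 1"
proof -
  note r = Sp_relation[OF assms, THEN arg_cong[where f = "of_int :: int \<Rightarrow> complex"]]
  show "transpose (blkA M) ** blkC M = transpose (blkC M) ** blkA M"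
    using r[of "Inl _" "Inl _"]
    by (simp add: vec_eq_iff blkA_def blkC_def matrix_matrix_mult_def transpose_def Jsympl_def)
  show "transpose (blkB M) ** blkD M = transpose (blkD M) ** blkB M"
    using r[of "Inr _" "Inr _"]
    by (simp add: vec_eq_iff blkB_def blkD_def matrix_matrix_mult_def transpose_def Jsympl_def)
  show "transpose (blkA M) ** blkD M - transpose (blkC M) ** blkB M = mat 1"
    using r[of "Inl _" "Inr _"]
    by (simp add: vec_eq_iff blkA_def blkB_def blkC_def blkD_def matrix_matrix_mult_def
        transpose_def Jsympl_def mat_def)
  then have "transpose (transpose (blkA M) ** blkD M - transpose (blkC M) ** blkB M) = mat 1"
    by simp
  moreover have "transpose (X - Y) = transpose X - transpose Y" for X Y :: "complex^'g^'g"
    by (simp add: transpose_def vec_eq_iff)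
  ultimately show "transpose (blkD M) ** blkA M - transpose (blkB M) ** blkC M = mat 1"
    by (simp add: matrix_transpose_mul)
qed

subsection \<open>The symplectic action\<close>

definition cnjv :: "complex^'n \<Rightarrow> complex^'n" where
  "cnjv v = (\<chi> i. cnj (v$i))"

lemma cnjv_add: "cnjv (v + w) = cnjv v + cnjv w"
  by (simp add: cnjv_def vec_eq_iff)

lemma cnj_cdot: "cnj (cdot v w) = cdot (cnjv v) (cnjv w)"
  by (simp add: cdot_def cnjv_def)

lemma cnjv_cnjv [simp]: "cnjv (cnjv v) = v"
  by (simp add: cnjv_def vec_eq_iff)

lemma cnjv_matrix:
  assumes "\<And>i j. cnj (M$i$j) = M$i$j"
  shows "cnjv (M *v v) = M *v cnjv v"
  using assms by (simp add: cnjv_def matrix_vector_mult_def vec_eq_iff)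

lemma cnj_blocks:
  "cnj (blkA M $ i $ j) = blkA M $ i $ j" "cnj (blkB M $ i $ j) = blkB M $ i $ j"
  "cnj (blkC M $ i $ j) = blkC M $ i $ j" "cnj (blkD M $ i $ j) = blkD M $ i $ j"
  by (simp_all add: blkA_def blkB_def blkC_def blkD_def)

lemma siegel_H_symmetric: "Z \<in> siegel_H \<Longrightarrow> transpose Z = Z"
  by (simp add: siegel_H_def)

text \<open>For w = x + iy the factors x_i y_j - y_i x_j that accompany Re Z are antisymmetric in
  (i, j) and cancel because Z is symmetric. Positivity on real vectors thus becomes positivity of a
  Hermitian form, which is easy to follow under the group action.\<close>

lemma Im_hermitian_form:
  fixes Z :: "complex^'g^'g"
  assumes "transpose Z = Z"
  defines "Y \<equiv> (\<chi> i j. Im (Z$i$j))"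
  shows "Im (cdot (cnjv w) (Z *v w)) =
    (\<chi> i. Re (w$i)) \<bullet> (Y *v (\<chi> i. Re (w$i))) + (\<chi> i. Im (w$i)) \<bullet> (Y *v (\<chi> i. Im (w$i)))"
proof -
  have s: "Z$i$j = Z$j$i" for i j
    using assms(1) by (metis transpose_def vec_lambda_beta)
  let ?R = "\<lambda>i j. (Re (w$i) * Im (w$j) - Im (w$i) * Re (w$j)) * Re (Z$i$j)"
  have "(\<Sum>i\<in>UNIV. \<Sum>j\<in>UNIV. ?R i j) = (\<Sum>i\<in>UNIV. \<Sum>j\<in>UNIV. ?R j i)"
    by (rule sum.swap)
  also have "\<dots> = (\<Sum>i\<in>UNIV. \<Sum>j\<in>UNIV. - ?R i j)"
    by (intro sum.cong refl) (simp add: s algebra_simps)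
  finally have R: "(\<Sum>i\<in>UNIV. \<Sum>j\<in>UNIV. ?R i j) = 0"
    by (simp add: sum_negf)
  have "Im (cdot (cnjv w) (Z *v w)) = (\<Sum>i\<in>UNIV. \<Sum>j\<in>UNIV. ?R i j +
      (Re (w$i) * Re (w$j) * Im (Z$i$j) + Im (w$i) * Im (w$j) * Im (Z$i$j)))"
    unfolding cdot_def matrix_vector_mult_def cnjv_def vec_lambda_beta sum_distrib_left Im_sum
    by (intro sum.cong refl) (simp add: algebra_simps)
  then show ?thesis
    unfolding sum.distrib R
    by (simp add: inner_vec_def matrix_vector_mult_def Y_def sum_distrib_left mult_ac)
qed

lemma siegel_H_hermitian_pos:
  fixes Z :: "complex^'g^'g"
  assumes Z: "Z \<in> siegel_H" and "w \<noteq> 0"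
  shows "Im (cdot (cnjv w) (Z *v w)) > 0"
proof -
  define Y :: "real^'g^'g" where "Y = (\<chi> i j. Im (Z$i$j))"
  have pos: "x \<noteq> 0 \<Longrightarrow> x \<bullet> (Y *v x) > 0" for x
    using Z by (simp add: siegel_H_def Y_def)
  then have nonneg: "x \<bullet> (Y *v x) \<ge> 0" for x
    by (cases "x = 0") (auto simp: less_imp_le)
  have "(\<chi> i. Re (w$i)) \<noteq> 0 \<or> (\<chi> i. Im (w$i)) \<noteq> 0"
    using \<open>w \<noteq> 0\<close> by (auto simp: vec_eq_iff complex_eq_iff)
  then show ?thesis
    unfolding Im_hermitian_form[OF siegel_H_symmetric[OF Z]] Y_def[symmetric]
    using pos nonneg by (smt (verit))
qed

lemma siegel_HI:
  fixes Z :: "complex^'g^'g"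
  assumes sym: "transpose Z = Z"
    and pos: "\<And>w. w \<noteq> 0 \<Longrightarrow> Im (cdot (cnjv w) (Z *v w)) > 0"
  shows "Z \<in> siegel_H"
proof -
  define Y :: "real^'g^'g" where "Y = (\<chi> i j. Im (Z$i$j))"
  have "x \<bullet> (Y *v x) > 0" if "x \<noteq> 0" for x
  proof -
    define w :: "complex^'g" where "w = (\<chi> i. of_real (x$i))"
    have "w \<noteq> 0" using that by (auto simp: w_def vec_eq_iff)
    moreover have "(\<chi> i. Re (w$i)) = x" "(\<chi> i. Im (w$i)) = 0"
      by (simp_all add: w_def vec_eq_iff)
    ultimately show ?thesis
      using pos[of w] unfolding Im_hermitian_form[OF sym] Y_def[symmetric] by simp
  qed
  then show ?thesis using sym by (simp add: siegel_H_def Y_def)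
qed

text \<open>\<open>numer\<close> and \<open>autom_J\<close> are the two blocks of \<open>M\<close>
  applied to the column with blocks Z and 1. Working with the pair postpones the matrix inverse
  contained in \<open>act\<close>.\<close>

definition numer :: "int^('g::finite+'g)^('g+'g) \<Rightarrow> complex^'g^'g \<Rightarrow> complex^'g^'g" where
  "numer M Z = blkA M ** Z + blkB M"

lemma act_eq: "act M Z = numer M Z ** matrix_inv (autom_J M Z)"
  by (simp add: act_def numer_def)

lemma transpose_add: "transpose (X + Y) = transpose X + transpose (Y :: complex^'n^'m)"
  by (simp add: transpose_def vec_eq_iff)

lemma matrix_add_rdistrib: "(Y + Z) ** X = Y ** X + Z ** (X :: complex^'n^'m)"
  by (simp add: matrix_matrix_mult_def vec_eq_iff distrib_right sum.distrib)

lemma matrix_diff_ldistrib: "X ** (Y - Z) = X ** Y - X ** (Z :: complex^'n^'m)"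
  by (simp add: matrix_matrix_mult_def vec_eq_iff right_diff_distrib sum_subtractf)

lemma matrix_diff_rdistrib: "(Y - Z) ** X = Y ** X - Z ** (X :: complex^'n^'m)"
  by (simp add: matrix_matrix_mult_def vec_eq_iff left_diff_distrib sum_subtractf)

text \<open>Symmetry of \<open>act M Z\<close> with denominators cleared. In the expansion the outer
  terms vanish by the block relations and the middle ones give Z - Z.\<close>

lemma numer_autom_J_symmetric:
  fixes M :: "int^('g::finite+'g)^('g+'g)"
  assumes M: "M \<in> Sp" and Z: "transpose Z = Z"
  shows "transpose (numer M Z) ** autom_J M Z = transpose (autom_J M Z) ** numer M Z"
proof -
  let ?A = "blkA M" and ?B = "blkB M" and ?C = "blkC M" and ?D = "blkD M"
  note b = Sp_blocks[OF M]
  have "transpose (numer M Z) ** autom_J M Z - transpose (autom_J M Z) ** numer M Z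
    = Z ** (transpose ?A ** ?C - transpose ?C ** ?A) ** Z
      + Z ** (transpose ?A ** ?D - transpose ?C ** ?B)
      - (transpose ?D ** ?A - transpose ?B ** ?C) ** Z
      + (transpose ?B ** ?D - transpose ?D ** ?B)"
    by (simp add: numer_def autom_J_def transpose_add matrix_transpose_mul Z matrix_add_ldistrib
        matrix_add_rdistrib matrix_diff_ldistrib matrix_diff_rdistrib matrix_mul_assoc)
  also have "\<dots> = 0" by (simp add: b)
  finally show ?thesis by simp
qed

text \<open>With X = \<open>act M Z\<close> symmetric, \<open>transpose (numer M Z)\<close> is J^t
  X, so this says that A - X C is the inverse of J^t. \<open>act_rank_one\<close> uses it in that
  form.\<close>

lemma autom_J_transpose_blkA:
  fixes M :: "int^('g::finite+'g)^('g+'g)"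
  assumes M: "M \<in> Sp" and Z: "transpose Z = Z"
  shows "transpose (autom_J M Z) ** blkA M - transpose (numer M Z) ** blkC M = mat 1"
proof -
  let ?A = "blkA M" and ?B = "blkB M" and ?C = "blkC M" and ?D = "blkD M"
  note b = Sp_blocks[OF M]
  have "transpose (autom_J M Z) ** ?A - transpose (numer M Z) ** ?C
    = (transpose ?D ** ?A - transpose ?B ** ?C) - Z ** (transpose ?A ** ?C - transpose ?C ** ?A)"
    by (simp add: numer_def autom_J_def transpose_add matrix_transpose_mul Z matrix_add_ldistrib
        matrix_add_rdistrib matrix_diff_ldistrib matrix_diff_rdistrib matrix_mul_assoc)
  then show ?thesis by (simp add: b)
qed

text \<open>A real symplectic matrix preserves the Hermitian form built from the symplectic form;
  here it is evaluated on the column with blocks Z w and w. Invertibility of \<open>autom_J\<close>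
  and positivity of the image both follow from it.\<close>

lemma Im_cdot_numer_autom_J:
  fixes M :: "int^('g::finite+'g)^('g+'g)"
  assumes M: "M \<in> Sp"
  shows "Im (cdot (cnjv (autom_J M Z *v w)) (numer M Z *v w)) = Im (cdot (cnjv w) (Z *v w))"
proof -
  let ?A = "blkA M" and ?B = "blkB M" and ?C = "blkC M" and ?D = "blkD M"
  note b = Sp_blocks[OF M]
  define z where "z = Z *v w"
  have J: "autom_J M Z *v w = ?C *v z + ?D *v w" and P: "numer M Z *v w = ?A *v z + ?B *v w"
    by (simp_all add: autom_J_def numer_def z_def matrix_vector_mul_assoc matrix_vector_mult_add_rdistrib)
  have conj: "cnjv (?A *v x) = ?A *v cnjv x" "cnjv (?B *v x) = ?B *v cnjv x"
    "cnjv (?C *v x) = ?C *v cnjv x" "cnjv (?D *v x) = ?D *v cnjv x" for x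
    by (simp_all add: cnjv_matrix cnj_blocks)
  \<comment> \<open>This term equals its own conjugate because A^t C is symmetric;
    \<open>Re2\<close> does the same with B^t D.\<close>
  have Re1: "Im (cdot (?C *v cnjv z) (?A *v z)) = 0"
  proof -
    have "cnj (cdot (?C *v cnjv z) (?A *v z)) = cdot (?C *v z) (?A *v cnjv z)"
      by (simp add: cnj_cdot conj)
    also have "\<dots> = cdot (?A *v cnjv z) (?C *v z)" by (rule cdot_commute)
    also have "\<dots> = cdot (?C *v cnjv z) (?A *v z)"
      by (simp add: cdot_matrix matrix_vector_mul_assoc b del: transpose_matrix_vector)
    finally show ?thesis by (simp add: complex_eq_iff)
  qed
  have Re2: "Im (cdot (?D *v cnjv w) (?B *v w)) = 0"
  proof -
    have "cnj (cdot (?D *v cnjv w) (?B *v w)) = cdot (?D *v w) (?B *v cnjv w)"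
      by (simp add: cnj_cdot conj)
    also have "\<dots> = cdot (?B *v cnjv w) (?D *v w)" by (rule cdot_commute)
    also have "\<dots> = cdot (?D *v cnjv w) (?B *v w)"
      by (simp add: cdot_matrix matrix_vector_mul_assoc b del: transpose_matrix_vector)
    finally show ?thesis by (simp add: complex_eq_iff)
  qed
  \<comment> \<open>Conjugation turns the mixed C-B term into a B-C term, so that the two mixed
    terms combine through D^t A - B^t C = 1.\<close>
  have "cnj (cdot (?C *v cnjv z) (?B *v w)) = cdot (?C *v z) (?B *v cnjv w)"
    by (simp add: cnj_cdot conj)
  also have "\<dots> = cdot (?B *v cnjv w) (?C *v z)" by (rule cdot_commute)
  finally have mixed: "Im (cdot (?C *v cnjv z) (?B *v w)) = - Im (cdot (?B *v cnjv w) (?C *v z))"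
    by (metis complex_cnj minus_minus complex.sel(2) complex_surj)
  have "cdot (?D *v cnjv w) (?A *v z) - cdot (?B *v cnjv w) (?C *v z)
      = cdot (cnjv w) ((transpose ?D ** ?A - transpose ?B ** ?C) *v z)"
    by (simp add: cdot_matrix matrix_vector_mul_assoc cdot_diff_right matrix_vector_mult_diff_rdistrib
        del: transpose_matrix_vector)
  also have "\<dots> = cdot (cnjv w) z" by (simp add: b)
  finally have "Im (cdot (?D *v cnjv w) (?A *v z)) - Im (cdot (?B *v cnjv w) (?C *v z))
      = Im (cdot (cnjv w) z)"
    by (metis minus_complex.sel(2))
  then show ?thesis
    using mixed Re1 Re2
    unfolding J P by (simp add: cnjv_add conj cdot_add_left cdot_add_right z_def)
qed

text \<open>A nonzero kernel vector would annihilate the preserved form, which is positive at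
  Z.\<close>

lemma autom_J_invertible:
  fixes M :: "int^('g::finite+'g)^('g+'g)"
  assumes M: "M \<in> Sp" and Z: "Z \<in> siegel_H"
  shows "invertible (autom_J M Z)"
proof -
  have "w = 0" if "autom_J M Z *v w = 0" for w
  proof (rule ccontr)
    assume "w \<noteq> 0"
    then have "Im (cdot (cnjv w) (Z *v w)) > 0" by (rule siegel_H_hermitian_pos[OF Z])
    then show False
      using Im_cdot_numer_autom_J[OF M, of Z w] that by (simp add: cdot_def cnjv_def)
  qed
  then obtain B where "B ** autom_J M Z = mat 1"
    using matrix_left_invertible_ker by blast
  then show ?thesis
    by (auto simp: invertible_def intro: matrix_left_right_inverse[THEN iffD1])
qed

lemma act_mult_autom_J:
  assumes "M \<in> Sp" "Z \<in> siegel_H"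
  shows "act M Z ** autom_J M Z = numer M Z"
  using matrix_inv_left[OF autom_J_invertible[OF assms]]
  by (simp add: act_eq matrix_mul_assoc[symmetric])

lemma matrix_right_cancel:
  fixes X Y :: "complex^'n^'n"
  assumes "invertible J" "X ** J = Y ** J"
  shows "X = Y"
  using assms by (metis matrix_inv_right matrix_mul_assoc matrix_mul_rid)

lemma act_siegel_H:
  fixes M :: "int^('g::finite+'g)^('g+'g)"
  assumes M: "M \<in> Sp" and Z: "Z \<in> siegel_H"
  shows "act M Z \<in> siegel_H"
proof (rule siegel_HI)
  let ?X = "act M Z" and ?J = "autom_J M Z" and ?P = "numer M Z"
  note XJ = act_mult_autom_J[OF M Z] and inv = autom_J_invertible[OF M Z]
  have "transpose ?X ** ?J = ?X ** ?J"
  proof -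
    let ?K = "transpose (matrix_inv ?J)"
    have K: "?K ** transpose ?J = mat 1"
      using matrix_inv_right[OF inv] by (metis matrix_transpose_mul transpose_mat)
    have "transpose ?X ** ?J = ?K ** (transpose ?P ** ?J)"
      by (simp add: act_eq matrix_transpose_mul matrix_mul_assoc)
    also have "\<dots> = ?K ** transpose ?J ** ?P"
      by (simp add: numer_autom_J_symmetric[OF M siegel_H_symmetric[OF Z]] matrix_mul_assoc)
    finally show ?thesis by (simp add: K XJ)
  qed
  then show "transpose ?X = ?X" by (rule matrix_right_cancel[OF inv])
  fix x :: "complex^'g" assume "x \<noteq> 0"
  \<comment> \<open>Substituting x = J w turns the form of \<open>act M Z\<close> at x into the form
    of Z at w.\<close>
  define w where "w = matrix_inv ?J *v x"
  have x: "?J *v w = x"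
    by (simp add: w_def matrix_vector_mul_assoc matrix_inv_right[OF inv])
  with \<open>x \<noteq> 0\<close> have "w \<noteq> 0" by auto
  have "?X *v x = ?P *v w"
    unfolding x[symmetric] by (simp add: matrix_vector_mul_assoc XJ)
  then have "Im (cdot (cnjv x) (?X *v x)) = Im (cdot (cnjv w) (Z *v w))"
    using Im_cdot_numer_autom_J[OF M, of Z w] x by simp
  also have "\<dots> > 0" by (rule siegel_H_hermitian_pos[OF Z \<open>w \<noteq> 0\<close>])
  finally show "Im (cdot (cnjv x) (?X *v x)) > 0" .
qed

lemma blocks_mult:
  fixes M N :: "int^('g::finite+'g)^('g+'g)"
  shows "blkA (M ** N) = blkA M ** blkA N + blkB M ** blkC N"
    and "blkB (M ** N) = blkA M ** blkB N + blkB M ** blkD N"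
    and "blkC (M ** N) = blkC M ** blkA N + blkD M ** blkC N"
    and "blkD (M ** N) = blkC M ** blkB N + blkD M ** blkD N"
  by (simp_all add: blkA_def blkB_def blkC_def blkD_def matrix_matrix_mult_def vec_eq_iff sum_UNIV_Plus)

lemma blocks_one:
  "blkA (mat 1 :: int^('g::finite+'g)^('g+'g)) = mat 1" "blkB (mat 1 :: int^('g+'g)^('g+'g)) = 0"
  "blkC (mat 1 :: int^('g+'g)^('g+'g)) = 0" "blkD (mat 1 :: int^('g+'g)^('g+'g)) = mat 1"
  by (simp_all add: blkA_def blkB_def blkC_def blkD_def mat_def vec_eq_iff)

text \<open>With X = \<open>act M Z\<close>, the column (Z, 1) is sent by \<open>M\<close> to (X, 1)
  J. Applying \<open>N\<close> must return (Z, 1), so numerator and denominator of \<open>N\<close>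
  at X, multiplied by J, are Z and 1.\<close>

lemma act_inverse:
  fixes M N :: "int^('g::finite+'g)^('g+'g)"
  assumes M: "M \<in> Sp" and N: "N \<in> Sp" and NM: "N ** M = mat 1" and Z: "Z \<in> siegel_H"
  shows "act N (act M Z) = Z"
proof -
  let ?X = "act M Z" and ?J = "autom_J M Z"
  note XJ = act_mult_autom_J[OF M Z]
  have "numer N ?X ** ?J = blkA N ** numer M Z + blkB N ** ?J"
    by (simp add: numer_def[of N] matrix_add_rdistrib matrix_mul_assoc[symmetric] XJ)
  also have "\<dots> = blkA (N ** M) ** Z + blkB (N ** M)"
    by (simp add: numer_def autom_J_def blocks_mult matrix_add_ldistrib matrix_add_rdistrib
        matrix_mul_assoc)
  finally have 1: "numer N ?X ** ?J = Z" by (simp add: NM blocks_one)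
  have "autom_J N ?X ** ?J = blkC N ** numer M Z + blkD N ** ?J"
    by (simp add: autom_J_def[of N] matrix_add_rdistrib matrix_mul_assoc[symmetric] XJ)
  also have "\<dots> = blkC (N ** M) ** Z + blkD (N ** M)"
    by (simp add: numer_def autom_J_def blocks_mult matrix_add_ldistrib matrix_add_rdistrib
        matrix_mul_assoc)
  finally have 2: "autom_J N ?X ** ?J = mat 1" by (simp add: NM blocks_one)
  have "act N ?X = act N ?X ** (autom_J N ?X ** ?J)" by (simp add: 2)
  also have "\<dots> = numer N ?X ** ?J"
    by (simp add: matrix_mul_assoc act_mult_autom_J[OF N act_siegel_H[OF M Z]])
  finally show ?thesis by (simp add: 1)
qed

lemma continuous_on_act:
  assumes "M \<in> Sp"
  shows "continuous_on siegel_H (act M)"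
  unfolding act_def
  by (intro continuous_on_matrix_mult continuous_on_matrix_inv autom_J_invertible assms)
    (auto simp: autom_J_def intro!: continuous_intros continuous_on_matrix_mult)

text \<open>As v^t = u^t J, the increment C v v^t equals (C v) u^t J, so J can be pulled out on the
  right and the perturbation becomes a factor of rank-one type.\<close>

lemma autom_J_rank_one:
  fixes M :: "int^('g::finite+'g)^('g+'g)" and Z :: "complex^'g^'g" and u :: "complex^'g"
  defines "v \<equiv> transpose (autom_J M Z) *v u"
  shows "autom_J M (Z + cscale t (outer v v)) = (mat 1 + outer (t *s (blkC M *v v)) u) ** autom_J M Z"
proof -
  have "blkC M ** cscale t (outer v v) = outer (t *s (blkC M *v v)) u ** autom_J M Z"
    by (simp add: cscale_outer matrix_mul_outer outer_mul_matrix v_def vector_scalar_commute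
        del: transpose_matrix_vector)
  then show ?thesis
    by (simp add: autom_J_def matrix_add_ldistrib matrix_add_rdistrib)
qed

lemma det_autom_J_rank_one:
  fixes M :: "int^('g::finite+'g)^('g+'g)" and Z :: "complex^'g^'g" and u :: "complex^'g"
  defines "v \<equiv> transpose (autom_J M Z) *v u"
  shows "det (autom_J M (Z + cscale t (outer v v)))
    = (1 + t * cdot u (blkC M *v v)) * det (autom_J M Z)"
proof -
  have "cdot (t *s (blkC M *v v)) u = t * cdot u (blkC M *v v)"
    by (simp add: cdot_scale cdot_commute)
  then show ?thesis
    unfolding v_def autom_J_rank_one by (simp add: det_mul det_mat_plus_outer)
qed

lemma transpose_autom_J_rank_one:
  fixes M :: "int^('g::finite+'g)^('g+'g)" and Z :: "complex^'g^'g" and u :: "complex^'g"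
  defines "v \<equiv> transpose (autom_J M Z) *v u"
  shows "transpose (autom_J M (Z + cscale t (outer v v))) *v u
    = (1 + t * cdot u (blkC M *v v)) *s v"
proof -
  have "cdot (t *s (blkC M *v v)) u = t * cdot u (blkC M *v v)"
    by (simp add: cdot_scale cdot_commute)
  then have "transpose (mat 1 + outer (t *s (blkC M *v v)) u) *v u
      = (1 + t * cdot u (blkC M *v v)) *s u"
    by (simp add: transpose_add transpose_outer matrix_vector_mult_add_rdistrib outer_vector
        vector_sadd_rdistrib del: transpose_matrix_vector)
  then have "transpose (autom_J M Z) *v (transpose (mat 1 + outer (t *s (blkC M *v v)) u) *v u)
      = (1 + t * cdot u (blkC M *v v)) *s v"
    by (simp only: vector_scalar_commute v_def)
  then show ?thesis
    unfolding v_def autom_J_rank_one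
    by (simp add: matrix_transpose_mul matrix_vector_mul_assoc del: transpose_matrix_vector)
qed

text \<open>Taking a rank-one direction avoids computing the full derivative of the action.\<close>

lemma act_rank_one:
  fixes M :: "int^('g::finite+'g)^('g+'g)" and Z :: "complex^'g^'g" and u :: "complex^'g"
  defines "v \<equiv> transpose (autom_J M Z) *v u"
  defines "\<kappa> \<equiv> cdot u (blkC M *v v)"
  assumes M: "M \<in> Sp" and Z: "Z \<in> siegel_H" and t: "1 + t * \<kappa> \<noteq> 0"
  shows "act M (Z + cscale t (outer v v)) = act M Z + cscale (t / (1 + t * \<kappa>)) (outer u u)"
proof -
  let ?J = "autom_J M Z" and ?X = "act M Z" and ?Z = "Z + cscale t (outer v v)"
  let ?N = "mat 1 + outer (t *s (blkC M *v v)) u"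
  let ?s = "t / (1 + t * \<kappa>)"
  note XJ = act_mult_autom_J[OF M Z] and inv = autom_J_invertible[OF M Z]
  \<comment> \<open>A - X C inverts J^t and hence sends v = J^t u back to u; this is where the
    direction u u^t of the image line comes from.\<close>
  have "transpose ?J ** (blkA M - ?X ** blkC M) = transpose ?J ** blkA M - transpose (transpose ?X ** ?J) ** blkC M"
    by (simp add: matrix_transpose_mul matrix_diff_ldistrib matrix_mul_assoc)
  also have "\<dots> = mat 1"
    unfolding siegel_H_symmetric[OF act_siegel_H[OF M Z]] XJ
    by (rule autom_J_transpose_blkA[OF M siegel_H_symmetric[OF Z]])
  finally have "(blkA M - ?X ** blkC M) ** transpose ?J = mat 1"
    by (simp add: matrix_left_right_inverse)
  then have "(blkA M - ?X ** blkC M) *v v = u"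
    unfolding v_def matrix_vector_mul_assoc by simp
  then have Av: "blkA M *v v = ?X *v (blkC M *v v) + u"
    by (simp add: matrix_vector_mult_diff_rdistrib matrix_vector_mul_assoc algebra_simps)
  have inv': "invertible (autom_J M ?Z)"
    using t inv by (simp add: invertible_det_nz det_autom_J_rank_one[folded v_def] \<kappa>_def v_def
        del: transpose_matrix_vector)
  \<comment> \<open>The equation s (1 + t \<kappa>) = t, which determines the parameter on the image
    line.\<close>
  have coeff: "?s + ?s * t * \<kappa> = t"
    using t by (simp add: divide_simps) (simp add: algebra_simps)
  \<comment> \<open>Rather than inverting the perturbed \<open>autom_J\<close>, the claimed image is
    multiplied by it and recognised as \<open>numer M ?Z\<close>.\<close>
  have "(?X + cscale ?s (outer u u)) ** ?N
      = ?X + outer (?s *s u + (t * \<kappa> * ?s) *s u + t *s (?X *v (blkC M *v v))) u"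
    by (simp add: matrix_add_ldistrib matrix_mul_outer cscale_outer outer_vector
        outer_add_left vector_scalar_commute matrix_vector_mult_add_rdistrib cdot_scale
        \<kappa>_def[symmetric] vector_add_ldistrib vector_smult_assoc mult_ac add_ac)
  also have "?s *s u + (t * \<kappa> * ?s) *s u + t *s (?X *v (blkC M *v v)) = t *s (blkA M *v v)"
    unfolding Av vector_sadd_rdistrib[symmetric] using coeff
    by (simp add: vector_add_ldistrib mult_ac)
  finally have "(?X + cscale ?s (outer u u)) ** (?N ** ?J) = (?X + outer (t *s (blkA M *v v)) u) ** ?J"
    by (simp only: matrix_mul_assoc)
  also have "\<dots> = numer M ?Z"
    by (simp add: matrix_add_rdistrib XJ outer_mul_matrix v_def[symmetric] numer_def
        matrix_add_ldistrib cscale_outer matrix_mul_outer vector_scalar_commute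
        del: transpose_matrix_vector)
  finally have "(?X + cscale ?s (outer u u)) ** autom_J M ?Z = numer M ?Z"
    unfolding v_def autom_J_rank_one .
  then have "(?X + cscale ?s (outer u u)) ** (autom_J M ?Z ** matrix_inv (autom_J M ?Z)) = act M ?Z"
    by (simp add: act_eq matrix_mul_assoc)
  then show ?thesis by (simp add: matrix_inv_right[OF inv'])
qed

subsection \<open>Complex differentiable functions of a matrix\<close>

text \<open>\<open>has_derivative\<close> is real Frechet differentiability; compatibility with
  \<open>cscale\<close> makes the derivative complex linear. This is the notion behind
  \<open>holo_on\<close>, stated without \<open>sym_part\<close>.\<close>

definition complex_diff_on :: "(complex^'g::finite^'g \<Rightarrow> complex) \<Rightarrow> (complex^'g^'g) set \<Rightarrow> bool" where
  "complex_diff_on F U \<longleftrightarrow>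
    (\<forall>z\<in>U. \<exists>L. (F has_derivative L) (at z) \<and> (\<forall>c x. L (cscale c x) = c * L x))"

text \<open>A one-variable \<open>deriv\<close>, like \<open>pderiv_dir\<close>, so it is defined
  for every function and matches \<open>D_raw\<close>. Linearity in the direction is available only
  once F is differentiable.\<close>

definition dderiv :: "(complex^'g::finite^'g \<Rightarrow> complex) \<Rightarrow> complex^'g^'g \<Rightarrow> complex^'g^'g \<Rightarrow> complex" where
  "dderiv F z w = deriv (\<lambda>t. F (z + cscale t w)) 0"

lemma cscale_simps [simp]:
  "cscale 1 M = M" "cscale 0 M = 0" "cscale c (cscale d M) = cscale (c * d) M"
  "cscale c (0 :: complex^'g^'h) = 0"
  by (simp_all add: cscale_def vec_eq_iff)

lemma norm_cscale: "norm (cscale c M) = cmod c * norm M"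
  by (simp add: cscale_def norm_vec_def norm_mult L2_set_right_distrib)

lemma bounded_linear_cscale_left: "bounded_linear (\<lambda>s. cscale s S)"
proof -
  have "linear (\<lambda>s. cscale s S)"
    by (intro linearI) (simp_all add: cscale_def vec_eq_iff distrib_right)
  then show ?thesis by (simp add: linear_conv_bounded_linear)
qed

lemma continuous_on_cscale [continuous_intros]:
  assumes "continuous_on T f"
  shows "continuous_on T (\<lambda>x. cscale (f x) S)"
  by (rule bounded_linear.continuous_on[OF bounded_linear_cscale_left assms])

lemma has_field_derivative_along_line:
  assumes "(F has_derivative L) (at (z + cscale t S))" "\<And>c x. L (cscale c x) = c * L x"
  shows "((\<lambda>s. F (z + cscale s S)) has_field_derivative L S) (at t)"
proof -
  have "((\<lambda>s. z + cscale s S) has_derivative (\<lambda>s. cscale s S)) (at t)"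
    using has_derivative_add[OF has_derivative_const
        bounded_linear.has_derivative[OF bounded_linear_cscale_left has_derivative_ident]]
    by simp
  from has_derivative_compose[OF this assms(1)]
  moreover have "(\<lambda>s. L (cscale s S)) = (*) (L S)"
    by (simp add: fun_eq_iff assms(2) mult.commute)
  ultimately show ?thesis
    by (simp add: has_field_derivative_def)
qed

lemma complex_diff_on_dderiv:
  assumes "complex_diff_on F U" "z \<in> U"
  shows "(F has_derivative dderiv F z) (at z)"
    and "\<And>c x. dderiv F z (cscale c x) = c * dderiv F z x"
    and "\<And>w. ((\<lambda>s. F (z + cscale s w)) has_field_derivative dderiv F z w) (at 0)"
proof -
  obtain L where L: "(F has_derivative L) (at z)" "\<And>c x. L (cscale c x) = c * L x"
    using assms by (auto simp: complex_diff_on_def)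
  have "((\<lambda>s. F (z + cscale s w)) has_field_derivative L w) (at 0)" for w
    by (rule has_field_derivative_along_line) (use L in auto)
  moreover from this have "dderiv F z = L"
    by (auto simp: dderiv_def fun_eq_iff intro: DERIV_imp_deriv)
  ultimately show "(F has_derivative dderiv F z) (at z)"
    "\<And>c x. dderiv F z (cscale c x) = c * dderiv F z x"
    "\<And>w. ((\<lambda>s. F (z + cscale s w)) has_field_derivative dderiv F z w) (at 0)"
    using L by simp_all
qed

lemma dderivI:
  "((\<lambda>s. F (z + cscale s w)) has_field_derivative d) (at 0) \<Longrightarrow> dderiv F z w = d"
  by (simp add: dderiv_def DERIV_imp_deriv)

lemma complex_diff_on_holomorphic_line:
  assumes "complex_diff_on F U"
  shows "(\<lambda>s. F (z + cscale s S)) holomorphic_on {s. z + cscale s S \<in> U}"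
  unfolding holomorphic_on_def field_differentiable_def
proof
  fix s assume "s \<in> {s. z + cscale s S \<in> U}"
  then obtain L where "(F has_derivative L) (at (z + cscale s S))" "\<And>c x. L (cscale c x) = c * L x"
    using assms by (auto simp: complex_diff_on_def)
  then have "((\<lambda>s. F (z + cscale s S)) has_field_derivative L S) (at s)"
    by (rule has_field_derivative_along_line)
  then show "\<exists>d. ((\<lambda>s. F (z + cscale s S)) has_field_derivative d) (at s within {s. z + cscale s S \<in> U})"
    using has_field_derivative_at_within by blast
qed

lemma complex_diff_on_continuous: "complex_diff_on F U \<Longrightarrow> continuous_on U F"
  by (meson complex_diff_on_dderiv(1) continuous_at_imp_continuous_on has_derivative_continuous)

lemma open_line: "open U \<Longrightarrow> open {s. z + cscale s S \<in> U}"
  using open_vimage[OF _ continuous_on_add[OF continuous_on_const continuous_on_cscale[OF continuous_on_id]],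
      of U z S]
  by (simp add: vimage_def)

section \<open>Cauchy's formula for directional derivatives and its consequences\<close>

definition circ :: "real \<Rightarrow> complex" where
  "circ s = exp (2 * of_real pi * \<i> * of_real s)"

lemma circ_norm [simp]: "cmod (circ s) = 1"
  by (simp add: circ_def)

lemma circ_nonzero [simp]: "circ s \<noteq> 0"
  by (simp add: circ_def)

lemma continuous_on_circ [continuous_intros]:
  "continuous_on T f \<Longrightarrow> continuous_on T (\<lambda>x. circ (f x))"
  unfolding circ_def by (intro continuous_intros)

text \<open>In Cauchy's formula for the first derivative, the speed 2 pi i \<open>circ s\<close> of
  the unit circle cancels the prefactor and one of two factors in the denominator. The radius is
  fixed at 1, so smallness has to be put into the direction \<open>w\<close>.\<close>

lemma dderiv_Cauchy:
  assumes F: "complex_diff_on F U" and "open U"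
    and in_U: "\<And>t. cmod t \<le> 1 \<Longrightarrow> z + cscale t w \<in> U"
  shows "dderiv F z w = integral {0..1} (\<lambda>s. F (z + cscale (circ s) w) / circ s)"
proof -
  let ?f = "\<lambda>t. F (z + cscale t w)"
  have hol: "?f holomorphic_on cball 0 1"
    by (rule holomorphic_on_subset[OF complex_diff_on_holomorphic_line[OF F]]) (auto intro: in_U)
  have "(?f has_field_derivative (1 / (2 * of_real pi * \<i>) *
      contour_integral (circlepath 0 1) (\<lambda>u. ?f u / (u - 0)^2))) (at 0)"
    by (rule Cauchy_derivative_integral_circlepath)
      (auto intro: holomorphic_on_imp_continuous_on[OF hol] holomorphic_on_subset[OF hol])
  then have "dderiv F z w
      = 1 / (2 * of_real pi * \<i>) * contour_integral (circlepath 0 1) (\<lambda>u. ?f u / (u - 0)^2)"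
    by (rule dderivI)
  also have "contour_integral (circlepath 0 1) (\<lambda>u. ?f u / (u - 0)^2)
      = integral {0..1} (\<lambda>s. (2 * of_real pi * \<i>) * (?f (circ s) / circ s))"
  proof -
    have "circlepath 0 1 = circ"
      by (simp add: circlepath circ_def fun_eq_iff)
    moreover from this have "vector_derivative circ (at s) = (2 * of_real pi * \<i>) * circ s" for s
      using vector_derivative_circlepath[of 0 1 s] by (simp add: circ_def)
    ultimately show ?thesis
      unfolding contour_integral_integral by (simp add: power2_eq_square mult_ac)
  qed
  also have "\<dots> = (2 * of_real pi * \<i>) * integral {0..1} (\<lambda>s. ?f (circ s) / circ s)"
    by (rule integral_mult_right)
  finally show ?thesis by simp
qed

text \<open>One factor \<rho> shrinks the direction enough for the unit discs at all points of a
  whole ball to fit into \<open>U\<close>, as \<open>dderiv_Cauchy\<close> requires.\<close>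

lemma polydisc_in_open:
  fixes w :: "complex^'g^'g"
  assumes "open U" "z0 \<in> U"
  obtains r \<rho> where "r > 0" "\<rho> > 0" "ball z0 r \<subseteq> U"
    "\<And>z t. z \<in> ball z0 r \<Longrightarrow> cmod t \<le> 1 \<Longrightarrow> z + cscale t (cscale (of_real \<rho>) w) \<in> U"
proof -
  obtain R where R: "R > 0" "ball z0 R \<subseteq> U"
    using assms by (auto simp: open_contains_ball)
  \<comment> \<open>Half of R is reserved for moving the base point and half for the disc; the
    summand 1 covers \<open>w = 0\<close>.\<close>
  define \<rho> where "\<rho> = R / (2 * (norm w + 1))"
  have \<rho>: "\<rho> > 0" using R by (simp add: \<rho>_def add_nonneg_pos)
  have "\<rho> * norm w \<le> R / 2"
  proof -
    have "\<rho> * norm w \<le> \<rho> * (norm w + 1)" using \<rho> by simp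
    also have "\<dots> = R / 2"
      using norm_ge_zero[of w] unfolding \<rho>_def by (simp add: field_simps add_nonneg_eq_0_iff)
    finally show ?thesis .
  qed
  have "z + cscale t (cscale (of_real \<rho>) w) \<in> U" if "z \<in> ball z0 (R/2)" "cmod t \<le> 1" for z t
  proof -
    have "norm (cscale t (cscale (of_real \<rho>) w)) = cmod t * (\<rho> * norm w)"
      using \<rho> by (simp only: norm_cscale norm_of_real abs_of_pos)
    also have "\<dots> \<le> 1 * (R / 2)"
      using that \<open>\<rho> * norm w \<le> R / 2\<close> \<rho> by (intro mult_mono) auto
    finally have "dist z (z + cscale t (cscale (of_real \<rho>) w)) \<le> R / 2"
      by (simp add: dist_norm del: cscale_simps)
    moreover have "dist z0 z < R / 2" using that by simp
    ultimately have "dist z0 (z + cscale t (cscale (of_real \<rho>) w)) < R"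
      by (smt (verit) dist_triangle field_sum_of_halves)
    then show ?thesis using R by auto
  qed
  moreover have "ball z0 (R/2) \<subseteq> U" using R by auto
  ultimately show ?thesis
    using that[of "R/2" \<rho>] R \<rho> by simp
qed

lemma dderiv_scale_real:
  assumes "complex_diff_on F U" "z \<in> U" "\<rho> > 0"
  shows "dderiv F z w = dderiv F z (cscale (of_real \<rho>) w) / of_real \<rho>"
  using complex_diff_on_dderiv(2)[OF assms(1,2)] assms(3) by simp

text \<open>Cauchy's formula makes the derivative a parameter integral of a continuous integrand.
  This continuity, which is not part of \<open>complex_diff_on\<close>, is what the Leibniz rule
  asks for in the next lemma.\<close>

lemma continuous_on_dderiv:
  assumes F: "complex_diff_on F U" and "open U"
  shows "continuous_on U (\<lambda>z. dderiv F z w)"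
proof -
  have "continuous (at z0) (\<lambda>z. dderiv F z w)" if z0: "z0 \<in> U" for z0
  proof -
    obtain r \<rho> where r: "r > 0" "\<rho> > 0" "ball z0 r \<subseteq> U"
      and in_U: "\<And>z t. z \<in> ball z0 r \<Longrightarrow> cmod t \<le> 1 \<Longrightarrow> z + cscale t (cscale (of_real \<rho>) w) \<in> U"
      using polydisc_in_open[OF \<open>open U\<close> z0, where w = w] by blast
    let ?w = "cscale (of_real \<rho>) w"
    have "continuous_on (ball z0 r \<times> cbox 0 1) (\<lambda>(z, s). F (z + cscale (circ s) ?w) / circ s)"
      unfolding split_beta
      by (intro continuous_intros continuous_on_compose2[OF complex_diff_on_continuous[OF F]])
        (auto simp del: cscale_simps intro!: in_U)
    then have "continuous_on (ball z0 r)
        (\<lambda>z. integral (cbox 0 1) (\<lambda>s. F (z + cscale (circ s) ?w) / circ s) / of_real \<rho>)"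
      by (intro continuous_intros integral_continuous_on_param) (use r in auto)
    then have "continuous_on (ball z0 r) (\<lambda>z. dderiv F z w)"
    proof (rule continuous_on_eq)
      fix z assume z: "z \<in> ball z0 r"
      show "integral (cbox 0 1) (\<lambda>s. F (z + cscale (circ s) ?w) / circ s) / of_real \<rho> = dderiv F z w"
        using dderiv_Cauchy[OF F \<open>open U\<close>, of z ?w, OF in_U[OF z]] z r
          dderiv_scale_real[OF F, of z \<rho> w] by (auto simp: cbox_interval)
    qed
    then show ?thesis
      using r by (simp add: continuous_on_eq_continuous_at)
  qed
  then show ?thesis by (simp add: continuous_at_imp_continuous_on)
qed

text \<open>Differentiation under the integral sign in Cauchy's formula.\<close>

lemma complex_diff_on_dderiv_complex_diff:
  assumes F: "complex_diff_on F U" and "open U"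
  shows "complex_diff_on (\<lambda>z. dderiv F z S) U"
  unfolding complex_diff_on_def
proof
  fix z0 assume z0: "z0 \<in> U"
  obtain r \<rho> where r: "r > 0" "\<rho> > 0" "ball z0 r \<subseteq> U"
    and in_U: "\<And>z t. z \<in> ball z0 r \<Longrightarrow> cmod t \<le> 1 \<Longrightarrow> z + cscale t (cscale (of_real \<rho>) S) \<in> U"
    using polydisc_in_open[OF \<open>open U\<close> z0, where w = S] by blast
  let ?w = "cscale (of_real \<rho>) S"
  \<comment> \<open>The z-derivative of Cauchy's integrand, packaged as a bounded linear map because
    \<open>leibniz_rule\<close> takes it in that form.\<close>
  define fx where "fx = (\<lambda>z s. Blinfun (\<lambda>h. dderiv F (z + cscale (circ s) ?w) h / circ s))"
  have bl: "bounded_linear (\<lambda>h. dderiv F (z + cscale (circ s) ?w) h / circ s)"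
    if "z \<in> ball z0 r" for z s
    using complex_diff_on_dderiv(1)[OF F in_U[OF that, of "circ s"]]
    by (intro bounded_linear_compose[OF bounded_linear_divide]) (simp add: has_derivative_bounded_linear del: cscale_simps)
  have fx: "blinfun_apply (fx z s) h = dderiv F (z + cscale (circ s) ?w) h / circ s"
    if "z \<in> ball z0 r" for z s h
    unfolding fx_def by (simp add: bounded_linear_Blinfun_apply[OF bl[OF that]] del: cscale_simps)
  have cont: "continuous_on (ball z0 r \<times> cbox 0 1) (\<lambda>(z, s). fx z s)"
  proof (rule continuous_on_blinfun_componentwise)
    fix i :: "complex^'a^'a" assume "i \<in> Basis"
    have "continuous_on (ball z0 r \<times> cbox 0 1)
        (\<lambda>x. dderiv F (fst x + cscale (circ (snd x)) ?w) i / circ (snd x))"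
      by (intro continuous_intros continuous_on_compose2[OF continuous_on_dderiv[OF F \<open>open U\<close>]])
        (auto simp del: cscale_simps intro!: in_U)
    then show "continuous_on (ball z0 r \<times> cbox 0 1) (\<lambda>x. blinfun_apply (case x of (z, s) \<Rightarrow> fx z s) i)"
      by (rule continuous_on_eq) (auto simp: fx simp del: cscale_simps)
  qed
  let ?G = "\<lambda>z. integral (cbox 0 1) (\<lambda>s. F (z + cscale (circ s) ?w) / circ s)"
  have "(?G has_derivative integral (cbox 0 1) (fx z0)) (at z0 within ball z0 r)"
  proof (rule leibniz_rule[OF _ _ cont])
    fix z and s :: real assume z: "z \<in> ball z0 r" and s: "s \<in> cbox 0 1"
    have "(F has_derivative dderiv F (z + cscale (circ s) ?w)) (at (z + cscale (circ s) ?w))"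
      by (rule complex_diff_on_dderiv(1)[OF F in_U[OF z]]) simp
    moreover have "((\<lambda>z. z + cscale (circ s) ?w) has_derivative (\<lambda>h. h)) (at z)"
      by (auto intro!: derivative_eq_intros)
    ultimately have "((\<lambda>z. F (z + cscale (circ s) ?w)) has_derivative dderiv F (z + cscale (circ s) ?w)) (at z)"
      using has_derivative_compose by blast
    then have "((\<lambda>z. F (z + cscale (circ s) ?w) / circ s) has_derivative
        (\<lambda>h. dderiv F (z + cscale (circ s) ?w) h / circ s)) (at z)"
      by (rule bounded_linear.has_derivative[OF bounded_linear_divide])
    moreover have "blinfun_apply (fx z s) = (\<lambda>h. dderiv F (z + cscale (circ s) ?w) h / circ s)"
      using fx[OF z] by blast
    ultimately show "((\<lambda>z. F (z + cscale (circ s) ?w) / circ s) has_derivative blinfun_apply (fx z s))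
        (at z within ball z0 r)"
      by (simp only: has_derivative_at_withinI)
  next
    fix z assume z: "z \<in> ball z0 r"
    show "(\<lambda>s. F (z + cscale (circ s) ?w) / circ s) integrable_on cbox 0 1"
      by (intro integrable_continuous continuous_intros
          continuous_on_compose2[OF complex_diff_on_continuous[OF F]])
        (auto simp del: cscale_simps intro!: in_U z)
  qed (use r in auto)
  then have "(?G has_derivative integral (cbox 0 1) (fx z0)) (at z0)"
    using r by (simp add: at_within_open[of z0 "ball z0 r"])
  then have "((\<lambda>z. ?G z / of_real \<rho>) has_derivative
      (\<lambda>h. integral (cbox 0 1) (fx z0) h / of_real \<rho>)) (at z0)"
    by (rule bounded_linear.has_derivative[OF bounded_linear_divide])
  then have "((\<lambda>z. dderiv F z S) has_derivative
      (\<lambda>h. integral (cbox 0 1) (fx z0) h / of_real \<rho>)) (at z0)"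
  proof (rule has_derivative_transform_within_open[of _ _ _ _ "ball z0 r"])
    fix z assume z: "z \<in> ball z0 r"
    show "?G z / of_real \<rho> = dderiv F z S"
      using dderiv_Cauchy[OF F \<open>open U\<close>, of z ?w, OF in_U[OF z]] z r
        dderiv_scale_real[OF F, of z \<rho> S] by (auto simp: cbox_interval)
  qed (use r in auto)
  \<comment> \<open>The Leibniz rule yields a real derivative only; complex linearity holds for each
    \<open>fx z0 s\<close> and passes through the integral.\<close>
  moreover have "integral (cbox 0 1) (fx z0) (cscale c x) = c * integral (cbox 0 1) (fx z0) x" for c x
  proof -
    have z0r: "z0 \<in> ball z0 r" using r by simp
    have "continuous_on (cbox 0 1) (\<lambda>s. fx z0 s)"
      by (rule continuous_on_compose2[OF cont, of _ "Pair z0", simplified])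
        (use r in \<open>auto intro!: continuous_intros\<close>)
    then have int: "fx z0 integrable_on cbox 0 1" by (rule integrable_continuous)
    have lin: "blinfun_apply (fx z0 s) (cscale c x) = c * blinfun_apply (fx z0 s) x" for s
      unfolding fx[OF z0r]
      by (subst complex_diff_on_dderiv(2)[OF F in_U[OF z0r]]) simp_all
    show ?thesis
      by (simp only: blinfun_apply_integral[OF int] lin integral_mult_right)
  qed
  ultimately show "\<exists>L. ((\<lambda>z. dderiv F z S) has_derivative L) (at z0) \<and> (\<forall>c x. L (cscale c x) = c * L x)"
    by (intro exI[of _ "\<lambda>h. integral (cbox 0 1) (fx z0) h / of_real \<rho>"]) simp
qed

subsection \<open>Holomorphic functions on symmetric matrices\<close>

lemma sym_part_id: "transpose Z = Z \<Longrightarrow> sym_part Z = Z"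
  by (auto simp: sym_part_def transpose_def vec_eq_iff)

lemma transpose_sym_part [simp]: "transpose (sym_part Z) = sym_part Z"
  by (auto simp: sym_part_def transpose_def vec_eq_iff add.commute)

lemma sym_part_idem [simp]: "sym_part (sym_part Z) = sym_part Z"
  by (simp add: sym_part_id)

lemma sym_part_line: "sym_part (z + cscale t S) = sym_part z + cscale t (sym_part S)"
  by (simp add: sym_part_def cscale_def vec_eq_iff field_simps)

lemma transpose_line:
  "transpose z = z \<Longrightarrow> transpose S = S \<Longrightarrow> transpose (z + cscale t S) = z + cscale t S"
  using sym_part_line[of z t S] by (metis sym_part_id transpose_sym_part)

lemma bounded_linear_sym_part: "bounded_linear (sym_part :: complex^'g^'g \<Rightarrow> _)"
proof -
  have "linear (sym_part :: complex^'g^'g \<Rightarrow> _)"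
    by (intro linearI) (simp_all add: sym_part_def vec_eq_iff complex_eq_iff field_simps)
  then show ?thesis by (simp add: linear_conv_bounded_linear)
qed

lemma continuous_on_sym_part: "continuous_on S sym_part"
  by (rule linear_continuous_on[OF bounded_linear_sym_part])

text \<open>For g > 1 no ball of the matrix space consists of symmetric matrices; these traces of
  balls are the basic relatively open sets, their preimages under \<open>sym_part\<close> being
  open.\<close>

definition symball :: "complex^'g::finite^'g \<Rightarrow> real \<Rightarrow> (complex^'g^'g) set" where
  "symball Z e = {W. transpose W = W \<and> dist Z W < e}"

lemma centre_in_symball: "transpose Z = Z \<Longrightarrow> e > 0 \<Longrightarrow> Z \<in> symball Z e"
  by (simp add: symball_def)

lemma symball_mono: "d \<le> e \<Longrightarrow> symball Z d \<subseteq> symball Z e"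
  by (auto simp: symball_def)

lemma symball_in_symball: "W \<in> symball Z e \<Longrightarrow> symball W (e - dist Z W) \<subseteq> symball Z e"
  by (auto simp: symball_def) (smt (verit) dist_triangle)

lemma rel_open_symball: "open (sym_part -` symball Z e)"
proof -
  have "sym_part -` symball Z e = sym_part -` ball Z e"
    by (auto simp: symball_def)
  then show ?thesis
    by (simp add: open_vimage continuous_on_sym_part)
qed

lemma convex_symball: "convex (symball Z e)"
proof -
  have "linear (\<lambda>W :: complex^'a^'a. transpose W - W)"
    by (intro linearI) (simp_all add: transpose_def vec_eq_iff algebra_simps)
  then have "convex ((\<lambda>W :: complex^'a^'a. transpose W - W) -` {0})"
    by (rule convex_linear_vimage) simp
  moreover have "symball Z e = (\<lambda>W. transpose W - W) -` {0} \<inter> ball Z e"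
    by (auto simp: symball_def)
  ultimately show ?thesis by (simp add: convex_Int)
qed

lemma rel_openE:
  assumes "open (sym_part -` V)" "Z \<in> V" "transpose Z = Z"
  obtains e where "e > 0" "symball Z e \<subseteq> V"
proof -
  obtain e where "e > 0" "ball Z e \<subseteq> sym_part -` V"
    using assms by (metis open_contains_ball sym_part_id vimageI)
  moreover have "symball Z e \<subseteq> V"
  proof
    fix W assume "W \<in> symball Z e"
    then have "W \<in> ball Z e" "sym_part W = W" by (auto simp: symball_def sym_part_id)
    then show "W \<in> V" using calculation(2) by (metis subsetD vimageD)
  qed
  ultimately show ?thesis using that by blast
qed

lemma rel_openI:
  assumes "\<And>Z. Z \<in> V \<Longrightarrow> \<exists>e>0. symball Z e \<subseteq> V"
  shows "open (sym_part -` V)"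
proof (subst open_subopen, intro ballI)
  fix x assume "x \<in> sym_part -` V"
  then obtain e where "e > 0" "symball (sym_part x) e \<subseteq> V"
    using assms by auto
  then show "\<exists>T. open T \<and> x \<in> T \<and> T \<subseteq> sym_part -` V"
    by (intro exI[of _ "sym_part -` symball (sym_part x) e"])
      (auto simp: rel_open_symball centre_in_symball)
qed

lemma complex_diff_on_cong:
  assumes "complex_diff_on F U" "open U" "\<And>z. z \<in> U \<Longrightarrow> F z = G z"
  shows "complex_diff_on G U"
  using assms unfolding complex_diff_on_def
  by (metis has_derivative_transform_within_open)

lemma complex_diff_on_const: "complex_diff_on (\<lambda>z. a) U"
  unfolding complex_diff_on_def by (auto intro!: exI[of _ "\<lambda>_. 0"])

lemma complex_diff_on_add:
  assumes F: "complex_diff_on F U" and G: "complex_diff_on G U"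
  shows "complex_diff_on (\<lambda>z. F z + G z) U"
  unfolding complex_diff_on_def
proof
  fix z assume z: "z \<in> U"
  show "\<exists>L. ((\<lambda>z. F z + G z) has_derivative L) (at z) \<and> (\<forall>c x. L (cscale c x) = c * L x)"
    by (intro exI[of _ "\<lambda>h. dderiv F z h + dderiv G z h"] conjI allI
        has_derivative_add complex_diff_on_dderiv(1)[OF F z] complex_diff_on_dderiv(1)[OF G z])
      (simp add: complex_diff_on_dderiv(2)[OF F z] complex_diff_on_dderiv(2)[OF G z] distrib_left)
qed

lemma complex_diff_on_mult:
  assumes F: "complex_diff_on F U" and G: "complex_diff_on G U"
  shows "complex_diff_on (\<lambda>z. F z * G z) U"
  unfolding complex_diff_on_def
proof
  fix z assume z: "z \<in> U"
  show "\<exists>L. ((\<lambda>z. F z * G z) has_derivative L) (at z) \<and> (\<forall>c x. L (cscale c x) = c * L x)"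
    by (intro exI[of _ "\<lambda>h. F z * dderiv G z h + dderiv F z h * G z"] conjI allI
        has_derivative_mult complex_diff_on_dderiv(1)[OF F z] complex_diff_on_dderiv(1)[OF G z])
      (simp add: complex_diff_on_dderiv(2)[OF F z] complex_diff_on_dderiv(2)[OF G z] algebra_simps)
qed

lemma complex_diff_on_divide:
  assumes F: "complex_diff_on F U" and G: "complex_diff_on G U" and nz: "\<And>z. z \<in> U \<Longrightarrow> G z \<noteq> 0"
  shows "complex_diff_on (\<lambda>z. F z / G z) U"
  unfolding complex_diff_on_def
proof
  fix z assume z: "z \<in> U"
  show "\<exists>L. ((\<lambda>z. F z / G z) has_derivative L) (at z) \<and> (\<forall>c x. L (cscale c x) = c * L x)"
    by (intro exI[of _ "\<lambda>h. (dderiv F z h * G z - F z * dderiv G z h) / (G z * G z)"] conjI allI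
        has_derivative_divide' complex_diff_on_dderiv(1)[OF F z] complex_diff_on_dderiv(1)[OF G z] nz z)
      (simp add: complex_diff_on_dderiv(2)[OF F z] complex_diff_on_dderiv(2)[OF G z] algebra_simps
        divide_simps)
qed

lemma holo_on_iff: "holo_on h V \<longleftrightarrow> complex_diff_on (\<lambda>z. h (sym_part z)) (sym_part -` V)"
  by (simp add: holo_on_def complex_diff_on_def comp_def)

lemma holo_on_subset: "holo_on h V \<Longrightarrow> W \<subseteq> V \<Longrightarrow> holo_on h W"
  by (auto simp: holo_on_def)

lemma holo_on_const: "holo_on (\<lambda>z. a) V"
  by (simp add: holo_on_iff complex_diff_on_const)

lemma holo_on_add: "holo_on f V \<Longrightarrow> holo_on g V \<Longrightarrow> holo_on (\<lambda>z. f z + g z) V"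
  by (simp add: holo_on_iff complex_diff_on_add)

lemma holo_on_mult: "holo_on f V \<Longrightarrow> holo_on g V \<Longrightarrow> holo_on (\<lambda>z. f z * g z) V"
  by (simp add: holo_on_iff complex_diff_on_mult)

lemma holo_on_diff: "holo_on f V \<Longrightarrow> holo_on g V \<Longrightarrow> holo_on (\<lambda>z. f z - g z) V"
  using holo_on_add[of f V "\<lambda>z. (-1) * g z", OF _ holo_on_mult[OF holo_on_const]] by simp

lemma holo_on_divide:
  "holo_on f V \<Longrightarrow> holo_on g V \<Longrightarrow> (\<And>z. z \<in> V \<Longrightarrow> g z \<noteq> 0) \<Longrightarrow> holo_on (\<lambda>z. f z / g z) V"
  unfolding holo_on_iff by (rule complex_diff_on_divide) auto

lemma holo_on_cong:
  "holo_on f V \<Longrightarrow> open (sym_part -` V) \<Longrightarrow> (\<And>z. z \<in> V \<Longrightarrow> f z = g z) \<Longrightarrow> holo_on g V"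
  unfolding holo_on_iff by (erule complex_diff_on_cong) auto

text \<open>Symmetrisation fixes a symmetric direction, so \<open>h\<close> and its extension
  through \<open>sym_part\<close> have the same difference quotients. This transfers results from
  open sets to \<open>holo_on\<close>.\<close>

lemma dderiv_sym_part:
  assumes "transpose S = S"
  shows "dderiv (\<lambda>z. h (sym_part z)) z S = dderiv h (sym_part z) S"
  by (simp add: dderiv_def sym_part_line sym_part_id[OF assms])

lemma holo_on_dderiv:
  assumes "holo_on h V" "open (sym_part -` V)" "transpose S = S"
  shows "holo_on (\<lambda>z. dderiv h z S) V"
  using complex_diff_on_dderiv_complex_diff[of "\<lambda>z. h (sym_part z)" "sym_part -` V" S] assms
  by (simp add: holo_on_iff dderiv_sym_part)

lemma holo_on_line:
  assumes h: "holo_on h V" and z: "z \<in> V" "transpose z = z" and S: "transpose S = S"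
  shows "((\<lambda>s. h (z + cscale s S)) has_field_derivative dderiv h z S) (at 0)"
proof -
  have "z \<in> sym_part -` V" using z by (simp add: sym_part_id)
  from complex_diff_on_dderiv(3)[OF h[unfolded holo_on_iff] this, of S]
  show ?thesis
    by (simp add: dderiv_sym_part[OF S] sym_part_line sym_part_id z S)
qed

text \<open>Additivity in the direction comes from the full Frechet derivative of the extension
  through \<open>sym_part\<close>; derivatives along single lines would not give it.\<close>

lemma dderiv_sum:
  assumes h: "holo_on h V" and z: "z \<in> V" "transpose z = z"
    and S: "\<And>i. i \<in> I \<Longrightarrow> transpose (S i) = S i" and fin: "finite I"
  shows "dderiv h z (\<Sum>i\<in>I. cscale (c i) (S i)) = (\<Sum>i\<in>I. c i * dderiv h z (S i))"
proof -
  have zU: "z \<in> sym_part -` V" using z by (simp add: sym_part_id)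
  note d = complex_diff_on_dderiv[OF h[unfolded holo_on_iff] zU]
  have T: "transpose (\<Sum>i\<in>I. cscale (c i) (S i)) = (\<Sum>i\<in>I. cscale (c i) (S i))"
    using S by (simp add: vec_eq_iff transpose_def cscale_def)
  have "dderiv (\<lambda>z. h (sym_part z)) z (\<Sum>i\<in>I. cscale (c i) (S i))
      = (\<Sum>i\<in>I. c i * dderiv (\<lambda>z. h (sym_part z)) z (S i))"
    by (simp add: d(2) linear_sum[OF has_derivative_linear[OF d(1)]])
  then show ?thesis
    using S by (simp add: dderiv_sym_part T sym_part_id z)
qed

lemma holo_on_nonzero_nbhd:
  assumes q: "holo_on q V" and V: "open (sym_part -` V)" and w: "w \<in> V" "transpose w = w" "q w \<noteq> 0"
  obtains e where "e > 0" "symball w e \<subseteq> V" "\<And>x. x \<in> symball w e \<Longrightarrow> q x \<noteq> 0"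
proof -
  have "w \<in> sym_part -` V" using w by (simp add: sym_part_id)
  then have "continuous (at w) (\<lambda>z. q (sym_part z))"
    using complex_diff_on_dderiv(1)[OF q[unfolded holo_on_iff]] has_derivative_continuous by blast
  then obtain e where e: "e > 0" "\<And>y. dist w y < e \<Longrightarrow> q (sym_part y) \<noteq> 0"
    using continuous_at_avoid[of w "\<lambda>z. q (sym_part z)" 0] w by (auto simp: sym_part_id)
  obtain e' where e': "e' > 0" "symball w e' \<subseteq> V" using rel_openE[OF V w(1,2)] .
  show ?thesis
  proof (rule that[of "min e e'"])
    show "symball w (min e e') \<subseteq> V" using e' by (auto simp: symball_def)
    show "q x \<noteq> 0" if "x \<in> symball w (min e e')" for x
      using e(2)[of x] that by (auto simp: symball_def sym_part_id)
  qed (use e e' in auto)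
qed

text \<open>The one-variable identity theorem on the complex line that has t at parameter 0 and w at
  parameter 1.\<close>

lemma holo_on_zero_symball:
  assumes q: "holo_on q (symball z e)" and t: "t \<in> symball z e" and "e' > 0"
    and zero: "\<And>w. w \<in> symball t e' \<Longrightarrow> q w = 0" and w: "w \<in> symball z e"
  shows "q w = 0"
proof -
  define \<Omega> where "\<Omega> = {s. t + cscale s (w - t) \<in> ball z e}"
  have t_sym: "transpose t = t" and w_sym: "transpose w = w"
    using t w by (auto simp: symball_def)
  have "transpose (w - t) = w - t"
    using t_sym w_sym by (simp add: transpose_def vec_eq_iff)
  then have sym: "transpose (t + cscale s (w - t)) = t + cscale s (w - t)" for s
    using transpose_line t_sym by blast
  have op: "open \<Omega>" unfolding \<Omega>_def by (rule open_line) simp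
  \<comment> \<open>The admissible parameters are the preimage of a ball under a linear map, hence
    convex, and the identity theorem gets its connected domain.\<close>
  have "\<Omega> = (\<lambda>s. cscale s (w - t)) -` ball (z - t) e"
    unfolding \<Omega>_def by (auto simp: dist_norm algebra_simps)
  then have "convex \<Omega>"
    by (simp add: convex_linear_vimage bounded_linear.linear[OF bounded_linear_cscale_left])
  have hol: "(\<lambda>s. q (sym_part (t + cscale s (w - t)))) holomorphic_on \<Omega>"
    by (rule holomorphic_on_subset[OF complex_diff_on_holomorphic_line[OF q[unfolded holo_on_iff]]])
      (auto simp: \<Omega>_def symball_def sym_part_id[OF sym])
  have "q (sym_part (t + cscale 1 (w - t))) = 0"
  proof (rule analytic_continuation_open[where g = "\<lambda>_. 0", OF _ op _ _ _ hol])
    show "open (\<Omega> \<inter> {s. t + cscale s (w - t) \<in> ball t e'})"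
      by (intro open_Int op open_line open_ball)
    show "\<Omega> \<inter> {s. t + cscale s (w - t) \<in> ball t e'} \<noteq> {}"
    proof -
      have "0 \<in> \<Omega> \<inter> {s. t + cscale s (w - t) \<in> ball t e'}"
        using t \<open>e' > 0\<close> by (simp add: \<Omega>_def symball_def)
      then show ?thesis by blast
    qed
    show "connected \<Omega>" using \<open>convex \<Omega>\<close> by (rule convex_connected)
    show "q (sym_part (t + cscale s (w - t))) = 0"
      if "s \<in> \<Omega> \<inter> {s. t + cscale s (w - t) \<in> ball t e'}" for s
      using that sym by (intro zero) (simp add: symball_def sym_part_id[OF sym])
    show "1 \<in> \<Omega>" using w by (simp add: \<Omega>_def symball_def)
  qed auto
  then show ?thesis by (simp add: sym_part_id w_sym)
qed

lemma holo_on_nonzero_dense: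
  assumes V: "open (sym_part -` V)" "connected V" and V_sym: "\<And>z. z \<in> V \<Longrightarrow> transpose z = z"
    and q: "holo_on q V" and z0: "z0 \<in> V" "q z0 \<noteq> 0" and z: "z \<in> V" and "d > 0"
  shows "\<exists>w\<in>V. dist z w < d \<and> q w \<noteq> 0"
proof (rule ccontr)
  assume contra: "\<not> ?thesis"
  \<comment> \<open>The points near which q vanishes identically. \<open>T\<close> will be open and
    closed in \<open>V\<close>; it contains \<open>z\<close> under the contrary assumption but never
    \<open>z0\<close>.\<close>
  define T where "T = {x\<in>V. \<exists>e>0. \<forall>w\<in>symball x e. q w = 0}"
  have "openin (top_of_set V) T"
    unfolding openin_contains_ball
  proof (intro conjI ballI)
    show "T \<subseteq> V" by (auto simp: T_def)
    fix x assume "x \<in> T"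
    then obtain e where e: "e > 0" "\<forall>w\<in>symball x e. q w = 0" by (auto simp: T_def)
    have "ball x e \<inter> V \<subseteq> T"
    proof
      fix y assume y: "y \<in> ball x e \<inter> V"
      then have "y \<in> symball x e" using V_sym by (auto simp: symball_def)
      from symball_in_symball[OF this] show "y \<in> T"
        using e y by (auto simp: T_def intro!: exI[of _ "e - dist x y"])
    qed
    then show "\<exists>e>0. ball x e \<inter> V \<subseteq> T" using e by blast
  qed
  moreover have "closedin (top_of_set V) T"
  proof -
    have "openin (top_of_set V) (V - T)"
      unfolding openin_contains_ball
    proof (intro conjI ballI)
      fix x assume x: "x \<in> V - T"
      then obtain e where e: "e > 0" "symball x e \<subseteq> V"
        using rel_openE[OF V(1)] V_sym by (metis DiffD1)
      \<comment> \<open>One point of \<open>T\<close> in a ball inside \<open>V\<close> forces q = 0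
        on the entire ball, so its centre x would lie in \<open>T\<close> as well.\<close>
      have "t \<notin> T" if t: "t \<in> ball x e" "t \<in> V" for t
      proof
        assume "t \<in> T"
        then obtain e' where "e' > 0" "\<forall>w\<in>symball t e'. q w = 0" by (auto simp: T_def)
        then have "\<forall>w\<in>symball x e. q w = 0"
          using holo_on_zero_symball[OF holo_on_subset[OF q e(2)], of t e'] t V_sym
          by (auto simp: symball_def)
        then have "x \<in> T" using x e by (auto simp: T_def)
        then show False using x by blast
      qed
      then show "\<exists>e>0. ball x e \<inter> V \<subseteq> V - T" using e by blast
    qed blast
    then show ?thesis by (auto simp: closedin_def T_def)
  qed
  ultimately have "T = {} \<or> T = V"
    using V(2) by (simp add: connected_clopen)
  moreover have "z0 \<notin> T"
    using z0 V_sym by (auto simp: T_def dest: centre_in_symball)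
  moreover have "z \<in> T"
  proof -
    obtain e where "e > 0" "symball z e \<subseteq> V" using rel_openE[OF V(1) z V_sym[OF z]] .
    then show ?thesis
      using contra z \<open>d > 0\<close> by (auto simp: T_def symball_def intro!: exI[of _ "min e d"])
  qed
  ultimately show False using z0 by blast
qed

subsection \<open>Meromorphic functions on the Siegel upper half space\<close>

text \<open>The clause "not identically zero on a connected set" of \<open>mero_on_H\<close> is
  replaced by "nonzero on a dense subset", which survives shrinking the ball and multiplying
  denominators.\<close>

definition local_quotient where
  "local_quotient f Z e h q \<longleftrightarrow> e > 0 \<and> symball Z e \<subseteq> siegel_H \<and>
    holo_on h (symball Z e) \<and> holo_on q (symball Z e) \<and>
    (\<forall>z\<in>symball Z e. \<forall>d>0. \<exists>w\<in>symball Z e. dist z w < d \<and> q w \<noteq> 0) \<and>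
    (\<forall>z\<in>symball Z e. q z \<noteq> 0 \<longrightarrow> f z = h z / q z)"

lemma local_quotientD:
  assumes "local_quotient f Z e h q"
  shows "e > 0" "symball Z e \<subseteq> siegel_H" "holo_on h (symball Z e)" "holo_on q (symball Z e)"
    and "\<And>z d. z \<in> symball Z e \<Longrightarrow> d > 0 \<Longrightarrow> \<exists>w\<in>symball Z e. dist z w < d \<and> q w \<noteq> 0"
    and "\<And>z. z \<in> symball Z e \<Longrightarrow> q z \<noteq> 0 \<Longrightarrow> f z = h z / q z"
  using assms unfolding local_quotient_def by blast+

lemma local_quotientI:
  assumes "e > 0" "symball Z e \<subseteq> siegel_H" "holo_on h (symball Z e)" "holo_on q (symball Z e)"
    and "\<And>z d. z \<in> symball Z e \<Longrightarrow> d > 0 \<Longrightarrow> \<exists>w\<in>symball Z e. dist z w < d \<and> q w \<noteq> 0"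
    and "\<And>z. z \<in> symball Z e \<Longrightarrow> q z \<noteq> 0 \<Longrightarrow> f z = h z / q z"
  shows "local_quotient f Z e h q"
  using assms unfolding local_quotient_def by blast

lemma local_quotient_mono:
  assumes "local_quotient f Z e h q" "0 < e'" "e' \<le> e"
  shows "local_quotient f Z e' h q"
proof -
  have sub: "symball Z e' \<subseteq> symball Z e" by (rule symball_mono) fact
  have "\<exists>w\<in>symball Z e'. dist z w < d \<and> q w \<noteq> 0" if z: "z \<in> symball Z e'" and d: "d > 0" for z d
  proof -
    have "z \<in> symball Z e" "min d (e' - dist Z z) > 0"
      using z d sub by (auto simp: symball_def)
    then obtain w where w: "w \<in> symball Z e" "dist z w < min d (e' - dist Z z)" "q w \<noteq> 0"
      using local_quotientD(5)[OF assms(1)] by blast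
    moreover have "w \<in> symball Z e'"
      using w z by (auto simp: symball_def) (smt (verit) dist_triangle)
    ultimately show ?thesis by auto
  qed
  note lq = local_quotientD[OF assms(1)]
  show ?thesis
    by (rule local_quotientI; (fact | rule holo_on_subset[OF lq(3) sub] holo_on_subset[OF lq(4) sub]
          order_trans[OF sub lq(2)] lq(6))?) (use sub in auto)
qed

lemma mero_on_H_local_quotient:
  assumes f: "mero_on_H f" and Z: "Z \<in> siegel_H"
  obtains e h q where "local_quotient f Z e h q"
proof -
  obtain V h q where V: "Z \<in> V" "V \<subseteq> siegel_H" "open (sym_part -` V)" "connected V"
    and hq: "holo_on h V" "holo_on q V" and nz: "\<exists>z\<in>V. q z \<noteq> 0"
    and eq: "\<forall>z\<in>V. q z \<noteq> 0 \<longrightarrow> f z = h z / q z"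
    using f Z unfolding mero_on_H_def by metis
  have sym: "\<And>z. z \<in> V \<Longrightarrow> transpose z = z" using V siegel_H_symmetric by blast
  obtain e where e: "e > 0" "symball Z e \<subseteq> V" using rel_openE[OF V(3,1) sym[OF V(1)]] .
  have "\<exists>w\<in>symball Z e. dist z w < d \<and> q w \<noteq> 0" if z: "z \<in> symball Z e" and d: "d > 0" for z d
  proof -
    have "min d (e - dist Z z) > 0" using z d by (simp add: symball_def)
    then obtain w where w: "w \<in> V" "dist z w < min d (e - dist Z z)" "q w \<noteq> 0"
      using holo_on_nonzero_dense[OF V(3,4) sym hq(2)] nz z e by blast
    moreover have "w \<in> symball Z e"
      using w sym by (auto simp: symball_def) (smt (verit) dist_triangle)
    ultimately show ?thesis by auto
  qed
  then have "local_quotient f Z e h q"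
    using eq by (intro local_quotientI e holo_on_subset[OF hq(1) e(2)] holo_on_subset[OF hq(2) e(2)]
        order_trans[OF e(2) V(2)]) (use e in auto)
  then show ?thesis by (rule that)
qed

lemma mero_on_HI:
  assumes "\<And>Z. Z \<in> siegel_H \<Longrightarrow> \<exists>e h q. local_quotient f Z e h q"
  shows "mero_on_H f"
  unfolding mero_on_H_def
proof
  fix Z :: "complex^'a^'a" assume Z: "Z \<in> siegel_H"
  then obtain e h q where lq: "local_quotient f Z e h q" using assms by blast
  note lqD = local_quotientD[OF lq]
  have "Z \<in> symball Z e" by (rule centre_in_symball[OF siegel_H_symmetric[OF Z] lqD(1)])
  moreover from this have "\<exists>z\<in>symball Z e. q z \<noteq> 0"
    using lqD(5)[of Z 1] by auto
  ultimately show "\<exists>V h q. Z \<in> V \<and> V \<subseteq> siegel_H \<and> open (sym_part -` V) \<and>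
      connected V \<and> holo_on h V \<and> holo_on q V \<and> (\<exists>z\<in>V. q z \<noteq> 0) \<and>
      (\<forall>z\<in>V. q z \<noteq> 0 \<longrightarrow> f z = h z / q z)"
    using lqD(2-4,6)
    by (intro exI[of _ "symball Z e"] exI[of _ h] exI[of _ q])
      (simp add: rel_open_symball convex_connected[OF convex_symball])
qed

text \<open>Near z there is a point with p nonzero; p stays nonzero on a ball about it, and density
  for q is then used inside that ball.\<close>

lemma local_quotient_nonzero_dense_mult:
  assumes p: "local_quotient f Z e h p" and q: "local_quotient g Z e k q"
    and z: "z \<in> symball Z e" and "d > 0"
  shows "\<exists>w\<in>symball Z e. dist z w < d \<and> p w * q w \<noteq> 0"
proof -
  have "d / 2 > 0" using \<open>d > 0\<close> by simp
  then obtain w where w: "w \<in> symball Z e" "dist z w < d/2" "p w \<noteq> 0"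
    using local_quotientD(5)[OF p z] by blast
  obtain e' where e': "e' > 0" "symball w e' \<subseteq> symball Z e" "\<And>x. x \<in> symball w e' \<Longrightarrow> p x \<noteq> 0"
    using holo_on_nonzero_nbhd[OF local_quotientD(4)[OF p] rel_open_symball w(1) _ w(3)] w(1)
    by (auto simp: symball_def)
  have "min e' (d/2) > 0" using e' \<open>d > 0\<close> by simp
  then obtain x where x: "x \<in> symball Z e" "dist w x < min e' (d/2)" "q x \<noteq> 0"
    using local_quotientD(5)[OF q w(1)] by blast
  then have "p x \<noteq> 0" using e'(3)[of x] by (auto simp: symball_def)
  moreover have "dist z x < d"
    using w x dist_triangle[of z x w] by simp
  ultimately show ?thesis using x by auto
qed

lemma mero_on_H_common:
  assumes "mero_on_H f" "mero_on_H g" "Z \<in> siegel_H"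
  obtains e h p k q where "local_quotient f Z e h p" "local_quotient g Z e k q"
proof -
  obtain e1 h p where 1: "local_quotient f Z e1 h p" using mero_on_H_local_quotient assms by blast
  obtain e2 k q where 2: "local_quotient g Z e2 k q" using mero_on_H_local_quotient assms by blast
  have "local_quotient f Z (min e1 e2) h p" "local_quotient g Z (min e1 e2) k q"
    using local_quotientD(1)[OF 1] local_quotientD(1)[OF 2]
    by (simp_all add: local_quotient_mono[OF 1] local_quotient_mono[OF 2])
  then show ?thesis by (rule that)
qed

lemma mero_on_H_add:
  assumes "mero_on_H f" "mero_on_H g"
  shows "mero_on_H (\<lambda>Z. f Z + g Z)"
proof (rule mero_on_HI)
  fix Z :: "complex^'a^'a" assume "Z \<in> siegel_H"
  then obtain e h p k q where lq: "local_quotient f Z e h p" "local_quotient g Z e k q"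
    using mero_on_H_common[OF assms] by metis
  note lq1 = local_quotientD(1-4,6)[OF lq(1)] and lq2 = local_quotientD(1-4,6)[OF lq(2)]
  have "local_quotient (\<lambda>Z. f Z + g Z) Z e (\<lambda>z. h z * q z + k z * p z) (\<lambda>z. p z * q z)"
  proof (rule local_quotientI)
    show "\<exists>w\<in>symball Z e. dist z w < d \<and> p w * q w \<noteq> 0" if "z \<in> symball Z e" "d > 0" for z d
      by (rule local_quotient_nonzero_dense_mult[OF lq that])
  qed (simp_all add: lq1 lq2 holo_on_add holo_on_mult divide_simps)
  then show "\<exists>e h q. local_quotient (\<lambda>Z. f Z + g Z) Z e h q" by blast
qed

lemma mero_on_H_mult:
  assumes "mero_on_H f" "mero_on_H g"
  shows "mero_on_H (\<lambda>Z. f Z * g Z)"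
proof (rule mero_on_HI)
  fix Z :: "complex^'a^'a" assume "Z \<in> siegel_H"
  then obtain e h p k q where lq: "local_quotient f Z e h p" "local_quotient g Z e k q"
    using mero_on_H_common[OF assms] by metis
  note lq1 = local_quotientD(1-4,6)[OF lq(1)] and lq2 = local_quotientD(1-4,6)[OF lq(2)]
  have "local_quotient (\<lambda>Z. f Z * g Z) Z e (\<lambda>z. h z * k z) (\<lambda>z. p z * q z)"
  proof (rule local_quotientI)
    show "\<exists>w\<in>symball Z e. dist z w < d \<and> p w * q w \<noteq> 0" if "z \<in> symball Z e" "d > 0" for z d
      by (rule local_quotient_nonzero_dense_mult[OF lq that])
  qed (simp_all add: lq1 lq2 holo_on_mult)
  then show "\<exists>e h q. local_quotient (\<lambda>Z. f Z * g Z) Z e h q" by blast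
qed

lemma mero_on_H_cmult:
  assumes "mero_on_H f"
  shows "mero_on_H (\<lambda>Z. a * f Z)"
proof (rule mero_on_HI)
  fix Z :: "complex^'a^'a" assume "Z \<in> siegel_H"
  then obtain e h q where lq: "local_quotient f Z e h q"
    using mero_on_H_local_quotient[OF assms] by metis
  note lqD = local_quotientD[OF lq]
  have "local_quotient (\<lambda>Z. a * f Z) Z e (\<lambda>z. a * h z) q"
    by (rule local_quotientI) (simp_all add: lqD holo_on_mult holo_on_const)
  then show "\<exists>e h q. local_quotient (\<lambda>Z. a * f Z) Z e h q" by blast
qed

text \<open>The empty sum is excluded because meromorphy of the zero function already contains
  relative openness of \<open>siegel_H\<close>.\<close>

lemma mero_on_H_sum:
  assumes "finite I" "I \<noteq> {}" "\<And>i. i \<in> I \<Longrightarrow> mero_on_H (f i)"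
  shows "mero_on_H (\<lambda>Z. \<Sum>i\<in>I. f i Z)"
  using assms by (induction I rule: finite_ne_induct) (auto intro!: mero_on_H_add)

lemma transpose_dirmat: "transpose (dirmat i j) = dirmat i j"
  unfolding dirmat_def transpose_def vec_eq_iff vec_lambda_beta
  by (intro allI, subst add.commute) (simp only: conj_commute)

text \<open>The quotient rule, with denominator q^2. Where q is nonzero, f equals h / q on a whole
  neighbourhood, so \<open>deriv\<close> of the actual values of f is the expected one.\<close>

lemma mero_on_H_dderiv:
  assumes "mero_on_H f" and S: "transpose S = S"
  shows "mero_on_H (\<lambda>Z. dderiv f Z S)"
proof (rule mero_on_HI)
  fix Z :: "complex^'a^'a" assume "Z \<in> siegel_H"
  then obtain e h q where lq: "local_quotient f Z e h q"
    using mero_on_H_local_quotient[OF assms(1)] by metis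
  note lqD = local_quotientD[OF lq]
  note h = lqD(3) and q = lqD(4) and eq = lqD(6)
  note op = rel_open_symball[of Z e]
  have "dderiv f z S = (dderiv h z S * q z - h z * dderiv q z S) / (q z * q z)"
    if z: "z \<in> symball Z e" and nz: "q z \<noteq> 0" for z
  proof (rule dderivI)
    have sym: "transpose z = z" using z by (simp add: symball_def)
    obtain d where d: "d > 0" "symball z d \<subseteq> symball Z e" "\<And>x. x \<in> symball z d \<Longrightarrow> q x \<noteq> 0"
      using holo_on_nonzero_nbhd[OF q op z sym nz] by blast
    have "((\<lambda>s. h (z + cscale s S) / q (z + cscale s S)) has_field_derivative
        (dderiv h z S * q z - h z * dderiv q z S) / (q z * q z)) (at 0)"
      using DERIV_divide[OF holo_on_line[OF h z sym S] holo_on_line[OF q z sym S]] nz by simp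
    then show "((\<lambda>s. f (z + cscale s S)) has_field_derivative
        (dderiv h z S * q z - h z * dderiv q z S) / (q z * q z)) (at 0)"
    proof (rule has_field_derivative_transform_within_open)
      show "open {s. z + cscale s S \<in> ball z d}" by (rule open_line) simp
      fix s assume "s \<in> {s. z + cscale s S \<in> ball z d}"
      then have "z + cscale s S \<in> symball z d"
        using transpose_line[OF sym S] by (simp add: symball_def)
      then show "h (z + cscale s S) / q (z + cscale s S) = f (z + cscale s S)"
        using d eq by fastforce
    qed (use d in simp)
  qed
  then have "local_quotient (\<lambda>Z. dderiv f Z S) Z e
      (\<lambda>z. dderiv h z S * q z - h z * dderiv q z S) (\<lambda>z. q z * q z)"
    by (intro local_quotientI)
      (simp_all add: lqD holo_on_dderiv[OF _ op S] holo_on_mult holo_on_diff)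
  then show "\<exists>e h q. local_quotient (\<lambda>Z. dderiv f Z S) Z e h q" by blast
qed

text \<open>Meromorphy at a point supplies a relatively open neighbourhood inside
  \<open>siegel_H\<close>, so one meromorphic function gives openness without estimates on positive
  definite matrices.\<close>

lemma rel_open_siegel_H:
  fixes f :: "complex^'g::finite^'g \<Rightarrow> complex"
  assumes "mero_on_H f"
  shows "open (sym_part -` (siegel_H :: (complex^'g^'g) set))"
proof (rule rel_openI)
  fix Z :: "complex^'g^'g" assume "Z \<in> siegel_H"
  then obtain e h q where "local_quotient f Z e h q"
    using mero_on_H_local_quotient[OF assms] by metis
  then show "\<exists>e>0. symball Z e \<subseteq> siegel_H" using local_quotientD(1,2) by blast
qed

section \<open>Dense relatively open subsets of the half space\<close>

definition dense_open_H :: "(complex^'g::finite^'g) set \<Rightarrow> bool" where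
  "dense_open_H V \<longleftrightarrow> V \<subseteq> siegel_H \<and> open (sym_part -` V) \<and> siegel_H \<subseteq> closure V"

lemma ae_eq_H_iff: "ae_eq_H f g \<longleftrightarrow> (\<exists>V. dense_open_H V \<and> (\<forall>Z\<in>V. f Z = g Z))"
  by (auto simp: ae_eq_H_def dense_open_H_def)

lemma dense_open_H_meets:
  assumes "dense_open_H V" "Z \<in> siegel_H" "e > 0"
  shows "\<exists>W\<in>V. W \<in> symball Z e"
proof -
  have "Z \<in> closure V" using assms by (auto simp: dense_open_H_def)
  then obtain W where "W \<in> V" "dist W Z < e" using \<open>e > 0\<close> closure_approachable by blast
  moreover have "transpose W = W"
    using \<open>W \<in> V\<close> assms siegel_H_symmetric by (auto simp: dense_open_H_def)
  ultimately show ?thesis by (auto simp: symball_def dist_commute)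
qed

lemma dense_open_H_nbhd:
  assumes "dense_open_H V" "Z \<in> V"
  obtains e where "e > 0" "symball Z e \<subseteq> V"
  using assms siegel_H_symmetric rel_openE[of V Z] by (auto simp: dense_open_H_def)

lemma dense_open_HI:
  assumes "V \<subseteq> siegel_H" "\<And>Z. Z \<in> V \<Longrightarrow> \<exists>e>0. symball Z e \<subseteq> V"
    "\<And>Z e. Z \<in> siegel_H \<Longrightarrow> e > 0 \<Longrightarrow> \<exists>W\<in>V. dist Z W < e"
  shows "dense_open_H V"
  using assms rel_openI[of V] by (auto simp: dense_open_H_def closure_approachable dist_commute)

lemma dense_open_H_Int:
  assumes V: "dense_open_H V" and W: "dense_open_H W"
  shows "dense_open_H (V \<inter> W)"
proof (rule dense_open_HI)
  show "V \<inter> W \<subseteq> siegel_H" using V by (auto simp: dense_open_H_def)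
  show "\<exists>e>0. symball Z e \<subseteq> V \<inter> W" if Z: "Z \<in> V \<inter> W" for Z
  proof -
    obtain d e where "d > 0" "symball Z d \<subseteq> V" "e > 0" "symball Z e \<subseteq> W"
      using dense_open_H_nbhd[OF V] dense_open_H_nbhd[OF W] Z by (metis IntE)
    then show ?thesis
      using symball_mono[of "min d e" d Z] symball_mono[of "min d e" e Z]
      by (intro exI[of _ "min d e"]) auto
  qed
  fix Z :: "complex^'a^'a" and e :: real assume "Z \<in> siegel_H" "e > 0"
  then obtain X where X: "X \<in> V" "X \<in> symball Z e" using dense_open_H_meets[OF V] by blast
  obtain d where d: "d > 0" "symball X d \<subseteq> V" using dense_open_H_nbhd[OF V X(1)] .
  have "min d (e - dist Z X) > 0" using d X by (simp add: symball_def)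
  moreover have "X \<in> siegel_H" using X V by (auto simp: dense_open_H_def)
  ultimately obtain Y where Y: "Y \<in> W" "Y \<in> symball X (min d (e - dist Z X))"
    using dense_open_H_meets[OF W] by blast
  then have "Y \<in> symball X d" "dist Z Y < e"
    using symball_mono[of "min d (e - dist Z X)" d X] dist_triangle[of Z Y X] by (auto simp: symball_def)
  then show "\<exists>Y\<in>V \<inter> W. dist Z Y < e" using Y d by blast
qed

lemma dense_open_H_INT:
  assumes "finite I" "I \<noteq> {}" "\<And>i. i \<in> I \<Longrightarrow> dense_open_H (V i)"
  shows "dense_open_H (\<Inter>i\<in>I. V i)"
  using assms by (induction I rule: finite_ne_induct) (auto intro!: dense_open_H_Int)

text \<open>Concerns the actual values of f near the point, not a corrected version with removable
  singularities filled in.\<close>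

definition regular_set :: "(complex^'g::finite^'g \<Rightarrow> complex) \<Rightarrow> (complex^'g^'g) set" where
  "regular_set f = {Z\<in>siegel_H. \<exists>e>0. symball Z e \<subseteq> siegel_H \<and> holo_on f (symball Z e)}"

lemma regular_setE:
  assumes "Z \<in> regular_set f"
  obtains e where "e > 0" "symball Z e \<subseteq> siegel_H" "holo_on f (symball Z e)" "Z \<in> symball Z e"
    "transpose Z = Z"
  using assms siegel_H_symmetric centre_in_symball by (auto simp: regular_set_def)

lemma dense_open_regular_set:
  assumes f: "mero_on_H f"
  shows "dense_open_H (regular_set f)"
proof (rule dense_open_HI)
  show "regular_set f \<subseteq> siegel_H" by (auto simp: regular_set_def)
  show "\<exists>e>0. symball Z e \<subseteq> regular_set f" if Z: "Z \<in> regular_set f" for Z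
  proof -
    obtain e where e: "e > 0" "symball Z e \<subseteq> siegel_H" "holo_on f (symball Z e)"
      using Z by (auto simp: regular_set_def)
    have "W \<in> regular_set f" if W: "W \<in> symball Z e" for W
    proof -
      note sub = symball_in_symball[OF W]
      have "symball W (e - dist Z W) \<subseteq> siegel_H" "holo_on f (symball W (e - dist Z W))"
        using sub e(2) holo_on_subset[OF e(3) sub] by auto
      moreover have "e - dist Z W > 0" "W \<in> siegel_H" using W e(2) by (auto simp: symball_def)
      ultimately show ?thesis unfolding regular_set_def by blast
    qed
    then show ?thesis using e by blast
  qed
  fix Z :: "complex^'a^'a" and d :: real assume Z: "Z \<in> siegel_H" "d > 0"
  then obtain e h q where lq: "local_quotient f Z e h q"
    using mero_on_H_local_quotient[OF f] by metis
  note lqD = local_quotientD[OF lq]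
  note h = lqD(3) and q = lqD(4)
  have "Z \<in> symball Z e" by (rule centre_in_symball[OF siegel_H_symmetric[OF Z(1)] lqD(1)])
  then obtain W where W: "W \<in> symball Z e" "dist Z W < d" "q W \<noteq> 0"
    using lqD(5) \<open>d > 0\<close> by blast
  obtain r where r: "r > 0" "symball W r \<subseteq> symball Z e" "\<And>x. x \<in> symball W r \<Longrightarrow> q x \<noteq> 0"
    using holo_on_nonzero_nbhd[OF q rel_open_symball W(1) _ W(3)] W(1) by (auto simp: symball_def)
  have "holo_on (\<lambda>z. h z / q z) (symball W r)"
    using h q r by (intro holo_on_divide) (auto intro: holo_on_subset)
  then have "holo_on f (symball W r)"
    by (rule holo_on_cong[OF _ rel_open_symball]) (use lqD(6) r in auto)
  moreover have "W \<in> siegel_H" "symball W r \<subseteq> siegel_H"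
    using W(1) r(2) lqD(2) by auto
  ultimately have "W \<in> regular_set f"
    using r(1) by (auto simp: regular_set_def)
  then show "\<exists>W\<in>regular_set f. dist Z W < d" using W by blast
qed

text \<open>Openness is continuity of \<open>act M\<close>. For density, a point of \<open>V\<close>
  near \<open>act M Z\<close> is pulled back by the continuous inverse \<open>act N\<close>, which
  takes \<open>act M Z\<close> to Z.\<close>

lemma dense_open_H_act_vimage:
  fixes M :: "int^('g::finite+'g)^('g+'g)"
  assumes M: "M \<in> Sp" and N: "N \<in> Sp" and inv: "M ** N = mat 1" "N ** M = mat 1"
    and H: "open (sym_part -` (siegel_H :: (complex^'g^'g) set))" and V: "dense_open_H V"
  shows "dense_open_H {Z\<in>siegel_H. act M Z \<in> V}"
proof (rule dense_open_HI)
  show "\<exists>e>0. symball Z e \<subseteq> {Z\<in>siegel_H. act M Z \<in> V}" if Z: "Z \<in> {Z\<in>siegel_H. act M Z \<in> V}" for Z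
  proof -
    obtain e where e: "e > 0" "symball (act M Z) e \<subseteq> V" using dense_open_H_nbhd[OF V] Z by blast
    obtain d where d: "d > 0" "\<And>W. W \<in> siegel_H \<Longrightarrow> dist W Z < d \<Longrightarrow> dist (act M W) (act M Z) < e"
      using continuous_on_act[OF M] Z e unfolding continuous_on_iff by fastforce
    obtain r where r: "r > 0" "symball Z r \<subseteq> siegel_H"
      using rel_openE[OF H] Z siegel_H_symmetric by blast
    have "W \<in> siegel_H \<and> act M W \<in> V" if W: "W \<in> symball Z (min r d)" for W
    proof -
      have "W \<in> symball Z r" using W symball_mono[of "min r d" r Z] by auto
      then have WH: "W \<in> siegel_H" using r by blast
      have "dist (act M W) (act M Z) < e" using W d(2)[OF WH] by (simp add: symball_def dist_commute)
      then have "act M W \<in> symball (act M Z) e"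
        using siegel_H_symmetric[OF act_siegel_H[OF M WH]] by (simp add: symball_def dist_commute)
      then show ?thesis using e WH by blast
    qed
    then show ?thesis using r d by (intro exI[of _ "min r d"]) auto
  qed
  fix Z :: "complex^'g^'g" and e :: real assume Z: "Z \<in> siegel_H" and "e > 0"
  let ?X = "act M Z"
  have X: "?X \<in> siegel_H" by (rule act_siegel_H[OF M Z])
  obtain d where d: "d > 0" "\<And>W. W \<in> siegel_H \<Longrightarrow> dist W ?X < d \<Longrightarrow> dist (act N W) (act N ?X) < e"
    using continuous_on_act[OF N] X \<open>e > 0\<close> unfolding continuous_on_iff by fastforce
  obtain W where W: "W \<in> V" "W \<in> symball ?X d" using dense_open_H_meets[OF V X d(1)] by blast
  have WH: "W \<in> siegel_H" using W V by (auto simp: dense_open_H_def)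
  have "dist (act N W) (act N ?X) < e" using W d(2)[OF WH] by (simp add: symball_def dist_commute)
  then have "dist Z (act N W) < e" by (simp add: act_inverse[OF M N inv(2) Z] dist_commute)
  moreover have "act N W \<in> {Z\<in>siegel_H. act M Z \<in> V}"
    using W by (simp add: act_siegel_H[OF N WH] act_inverse[OF N M inv(1) WH])
  ultimately show "\<exists>W\<in>{Z\<in>siegel_H. act M Z \<in> V}. dist Z W < e" by blast
qed auto

subsection \<open>Polynomials in the formal vector\<close>

definition monom_eval :: "('g::finite \<Rightarrow> nat) \<Rightarrow> complex^'g \<Rightarrow> complex" where
  "monom_eval \<alpha> u = (\<Prod>i\<in>UNIV. u$i ^ \<alpha> i)"

lemma finite_monoms: "finite (monoms m :: ('g::finite \<Rightarrow> nat) set)"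
proof (rule finite_subset)
  show "monoms m \<subseteq> (PiE UNIV (\<lambda>_. {..m}) :: ('g \<Rightarrow> nat) set)"
    by (auto simp: monoms_def intro: member_le_sum)
qed (simp add: finite_PiE)

lemma monoms_nonempty: "monoms m \<noteq> ({} :: ('g::finite \<Rightarrow> nat) set)"
proof -
  have "(\<lambda>i. if i = undefined then m else 0) \<in> (monoms m :: ('g \<Rightarrow> nat) set)"
    by (simp add: monoms_def)
  then show ?thesis by blast
qed

lemma polyev_component: "polyev m c u $ l = (\<Sum>\<alpha>\<in>monoms m. monom_eval \<alpha> u * c \<alpha> $ l)"
  by (simp add: polyev_def monom_eval_def)

lemma monom_eval_scale: "\<alpha> \<in> monoms m \<Longrightarrow> monom_eval \<alpha> (a *s u) = a ^ m * monom_eval \<alpha> u"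
  by (simp add: monom_eval_def monoms_def power_mult_distrib prod.distrib power_sum[symmetric])

lemma polyev_scale: "polyev m c (a *s u) = a ^ m *s polyev m c u"
  by (simp add: vec_eq_iff polyev_component monom_eval_scale sum_distrib_left mult.assoc)

text \<open>The exponent of u_i u_j u^\<alpha>. The two indicators add, so i = j raises one exponent
  by 2.\<close>

definition raise_exp :: "'g \<times> 'g \<times> ('g \<Rightarrow> nat) \<Rightarrow> 'g \<Rightarrow> nat" where
  "raise_exp x = (case x of (i, j, \<alpha>) \<Rightarrow> \<lambda>k. \<alpha> k + (if k = i then 1 else 0) + (if k = j then 1 else 0))"

lemma raise_exp_monoms: "\<alpha> \<in> monoms m \<Longrightarrow> raise_exp (i, j, \<alpha>) \<in> monoms (m + 2)"
  by (simp add: raise_exp_def monoms_def sum.distrib)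

lemma monom_eval_raise: "monom_eval (raise_exp (i, j, \<alpha>)) u = u$i * u$j * monom_eval \<alpha> u"
proof -
  have "(\<Prod>k\<in>UNIV. u$k ^ (if k = i then 1 else 0)) = u$i" for i
    by (simp add: if_distrib[of "(^) _"] cong: if_cong)
  then show ?thesis
    by (simp add: monom_eval_def raise_exp_def power_add prod.distrib mult_ac del: power_Suc)
qed

abbreviation raise_dom :: "nat \<Rightarrow> ('g::finite \<times> 'g \<times> ('g \<Rightarrow> nat)) set" where
  "raise_dom m \<equiv> UNIV \<times> UNIV \<times> monoms m"

text \<open>Different triples can yield the same monomial, so a coefficient in degree m + 2 is a sum
  over a fibre of \<open>raise_exp\<close>; the proof regroups by fibres.\<close>

lemma polyev_raise:
  "polyev (m + 2) (\<lambda>\<beta>. \<Sum>x\<in>{x\<in>raise_dom m. raise_exp x = \<beta>}. X x) u $ l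
    = (\<Sum>(i, j, \<alpha>)\<in>raise_dom m. u$i * u$j * monom_eval \<alpha> u * X (i, j, \<alpha>) $ l)"
proof -
  have "polyev (m + 2) (\<lambda>\<beta>. \<Sum>x\<in>{x\<in>raise_dom m. raise_exp x = \<beta>}. X x) u $ l
      = (\<Sum>\<beta>\<in>monoms (m + 2). \<Sum>x\<in>{x\<in>raise_dom m. raise_exp x = \<beta>}. monom_eval (raise_exp x) u * X x $ l)"
    by (simp add: polyev_component sum_component sum_distrib_left)
  also have "\<dots> = (\<Sum>x\<in>raise_dom m. monom_eval (raise_exp x) u * X x $ l)"
    by (rule sum.group) (auto simp: finite_monoms raise_exp_monoms simp del: add_2_eq_Suc')
  finally show ?thesis
    by (simp add: monom_eval_raise split_beta cong: sum.cong)
      (rule sum.cong, auto simp: monom_eval_raise)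
qed

text \<open>The sum runs over ordered pairs, so each off-diagonal entry receives two halves, while
  \<open>dirmat i i\<close> has the full entry 1/2 + 1/2 on the diagonal.\<close>

lemma outer_eq_sum_dirmat:
  "outer u u = (\<Sum>(i, j)\<in>UNIV. cscale (u$i * u$j) (dirmat i j))"
proof -
  have 1: "(\<Sum>i\<in>UNIV. \<Sum>j\<in>UNIV. u$i * u$j * (if a = i \<and> b = j then 1/2 else 0)) = u$a * u$b / 2"
    for a b
  proof -
    have "u$i * u$j * (if a = i \<and> b = j then 1/2 else 0)
        = (if b = j then if a = i then u$a * u$b / 2 else 0 else 0)" for i j
      by simp
    then show ?thesis by simp
  qed
  have 2: "(\<Sum>i\<in>UNIV. \<Sum>j\<in>UNIV. u$i * u$j * (if a = j \<and> b = i then 1/2 else 0)) = u$a * u$b / 2"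
    for a b
  proof -
    have "u$i * u$j * (if a = j \<and> b = i then 1/2 else 0)
        = (if a = j then if b = i then u$a * u$b / 2 else 0 else 0)" for i j
      by simp
    then show ?thesis by simp
  qed
  have "(\<Sum>(i, j)\<in>UNIV. cscale (u$i * u$j) (dirmat i j)) $ a $ b = u$a * u$b" for a b
    unfolding UNIV_Times_UNIV[symmetric] sum.cartesian_product[symmetric]
    by (simp add: cscale_def dirmat_def distrib_left sum.distrib 1 2)
  then show ?thesis by (simp add: vec_eq_iff outer_def)
qed

lemma quadratic_form_eq: "(\<Sum>i\<in>UNIV. \<Sum>j\<in>UNIV. u$i * M$i$j * u$j) = cdot u (M *v u)"
  by (simp add: cdot_def matrix_vector_mult_def sum_distrib_left mult.assoc)

subsection \<open>Differentiating vector-valued forms\<close>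

text \<open>The derivative of Phi(.)[u] with u frozen, expressed through coefficients. Keeping
  \<open>u\<close> and \<open>S\<close> independent allows linearity in \<open>S\<close> before
  \<open>S = outer u u\<close> is inserted.\<close>

definition coeff_dderiv ::
  "nat \<Rightarrow> (complex^'g^'g \<Rightarrow> ('g::finite \<Rightarrow> nat) \<Rightarrow> complex^'n) \<Rightarrow> complex^'g^'g \<Rightarrow> complex^'g
    \<Rightarrow> complex^'g^'g \<Rightarrow> 'n \<Rightarrow> complex" where
  "coeff_dderiv m c Z u S l = (\<Sum>\<alpha>\<in>monoms m. monom_eval \<alpha> u * dderiv (\<lambda>W. c W \<alpha> $ l) Z S)"

text \<open>On such a set \<open>\<Phi>\<close> may be differentiated coefficientwise: by openness,
  equality with the polynomial persists near each point.\<close>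

definition poly_regular where
  "poly_regular m c \<Phi> V \<longleftrightarrow> dense_open_H V \<and> (\<forall>Z\<in>V. \<Phi> Z = polyev m (c Z)) \<and>
    (\<forall>Z\<in>V. \<forall>\<alpha>\<in>monoms m. \<forall>l. Z \<in> regular_set (\<lambda>W. c W \<alpha> $ l))"

lemma poly_regular_exists:
  fixes c :: "complex^'g::finite^'g \<Rightarrow> ('g \<Rightarrow> nat) \<Rightarrow> complex^'n"
  assumes c: "\<And>\<alpha> l. \<alpha> \<in> monoms m \<Longrightarrow> mero_on_H (\<lambda>Z. c Z \<alpha> $ l)"
    and ae: "ae_eq_H \<Phi> (\<lambda>Z. polyev m (c Z))"
  obtains V where "poly_regular m c \<Phi> V"
proof -
  obtain V where V: "dense_open_H V" "\<forall>Z\<in>V. \<Phi> Z = polyev m (c Z)"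
    using ae unfolding ae_eq_H_iff by blast
  let ?R = "\<Inter>x\<in>monoms m \<times> UNIV. regular_set (\<lambda>W. c W (fst x) $ snd x)"
  have "dense_open_H ?R"
    by (rule dense_open_H_INT) (auto simp: finite_monoms monoms_nonempty c dense_open_regular_set)
  then have "poly_regular m c \<Phi> (V \<inter> ?R)"
    using V by (auto simp: poly_regular_def dense_open_H_Int)
  then show ?thesis by (rule that)
qed

lemma dense_open_H_eventually_line:
  assumes V: "dense_open_H V" and Z: "Z \<in> V" and S: "transpose S = S"
  shows "\<exists>T. open T \<and> 0 \<in> T \<and> (\<forall>t\<in>T. Z + cscale t S \<in> V)"
proof -
  obtain e where e: "e > 0" "symball Z e \<subseteq> V" using dense_open_H_nbhd[OF V Z] .
  have "transpose Z = Z" using V Z siegel_H_symmetric by (auto simp: dense_open_H_def)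
  then have "Z + cscale t S \<in> V" if "Z + cscale t S \<in> ball Z e" for t
    using e that transpose_line[of Z S t] S by (auto simp: symball_def)
  then show ?thesis
    using e open_line[of "ball Z e" Z S]
    by (intro exI[of _ "{t. Z + cscale t S \<in> ball Z e}"]) simp
qed

lemma has_field_derivative_form:
  assumes V: "poly_regular m c \<Phi> V" and Z: "Z \<in> V" and S: "transpose S = S"
  shows "((\<lambda>t. \<Phi> (Z + cscale t S) u $ l) has_field_derivative coeff_dderiv m c Z u S l) (at 0)"
proof -
  have "((\<lambda>t. c (Z + cscale t S) \<alpha> $ l) has_field_derivative dderiv (\<lambda>W. c W \<alpha> $ l) Z S) (at 0)"
    if "\<alpha> \<in> monoms m" for \<alpha>
  proof -
    have "Z \<in> regular_set (\<lambda>W. c W \<alpha> $ l)" using V Z that by (auto simp: poly_regular_def)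
    then obtain e where "holo_on (\<lambda>W. c W \<alpha> $ l) (symball Z e)" "Z \<in> symball Z e" "transpose Z = Z"
      by (rule regular_setE)
    then show ?thesis by (rule holo_on_line) (rule S)
  qed
  then have D: "((\<lambda>t. \<Sum>\<alpha>\<in>monoms m. monom_eval \<alpha> u * c (Z + cscale t S) \<alpha> $ l)
      has_field_derivative coeff_dderiv m c Z u S l) (at 0)"
    unfolding coeff_dderiv_def by (intro DERIV_sum DERIV_cmult)
  obtain T where T: "open T" "0 \<in> T" "\<forall>t\<in>T. Z + cscale t S \<in> V"
    using dense_open_H_eventually_line[OF _ Z S] V by (auto simp: poly_regular_def)
  show ?thesis using D T(1,2)
  proof (rule has_field_derivative_transform_within_open)
    show "(\<Sum>\<alpha>\<in>monoms m. monom_eval \<alpha> u * c (Z + cscale t S) \<alpha> $ l) = \<Phi> (Z + cscale t S) u $ l"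
      if "t \<in> T" for t
      using T(3) that V by (simp add: poly_regular_def polyev_component)
  qed
qed

lemma pderiv_dir_form:
  assumes "poly_regular m c \<Phi> V" "Z \<in> V" "transpose S = S"
  shows "pderiv_dir (\<lambda>W. \<Phi> W u) Z S $ l = coeff_dderiv m c Z u S l"
  using has_field_derivative_form[OF assms] by (simp add: pderiv_dir_def DERIV_imp_deriv)

lemma D_raw_form:
  assumes "poly_regular m c \<Phi> V" "Z \<in> V"
  shows "D_raw \<Phi> Z u $ l
    = (\<Sum>i\<in>UNIV. \<Sum>j\<in>UNIV. u$i * u$j * (1 / (2 * pi * \<i>) * coeff_dderiv m c Z u (dirmat i j) l))"
  by (simp add: D_raw_def sum_component pderiv_dir_form[OF assms transpose_dirmat])

lemma coeff_dderiv_outer: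
  assumes V: "poly_regular m c \<Phi> V" and Z: "Z \<in> V"
  shows "coeff_dderiv m c Z u (outer w w) l
    = (\<Sum>i\<in>UNIV. \<Sum>j\<in>UNIV. w$i * w$j * coeff_dderiv m c Z u (dirmat i j) l)"
proof -
  have "dderiv (\<lambda>W. c W \<alpha> $ l) Z (outer w w)
      = (\<Sum>x\<in>UNIV. w$fst x * w$snd x * dderiv (\<lambda>W. c W \<alpha> $ l) Z (dirmat (fst x) (snd x)))"
    if "\<alpha> \<in> monoms m" for \<alpha>
  proof -
    have "Z \<in> regular_set (\<lambda>W. c W \<alpha> $ l)" using V Z that by (auto simp: poly_regular_def)
    then obtain e where "holo_on (\<lambda>W. c W \<alpha> $ l) (symball Z e)" "Z \<in> symball Z e" "transpose Z = Z"
      by (rule regular_setE)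
    then show ?thesis
      unfolding outer_eq_sum_dirmat split_beta by (rule dderiv_sum) (auto simp: transpose_dirmat)
  qed
  then have "coeff_dderiv m c Z u (outer w w) l
      = (\<Sum>\<alpha>\<in>monoms m. \<Sum>x\<in>UNIV. w$fst x * w$snd x *
          (monom_eval \<alpha> u * dderiv (\<lambda>W. c W \<alpha> $ l) Z (dirmat (fst x) (snd x))))"
    unfolding coeff_dderiv_def by (intro sum.cong refl) (simp add: sum_distrib_left mult_ac)
  also have "\<dots> = (\<Sum>x\<in>UNIV. w$fst x * w$snd x * coeff_dderiv m c Z u (dirmat (fst x) (snd x)) l)"
    unfolding coeff_dderiv_def sum_distrib_left by (rule sum.swap)
  finally show ?thesis
    unfolding UNIV_Times_UNIV[symmetric] sum.cartesian_product split_beta by simp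
qed

lemma D_raw_eq_outer:
  assumes "poly_regular m c \<Phi> V" "Z \<in> V"
  shows "D_raw \<Phi> Z u $ l = coeff_dderiv m c Z u (outer u u) l / (2 * pi * \<i>)"
  by (simp add: D_raw_form[OF assms] coeff_dderiv_outer[OF assms] sum_divide_distrib)

text \<open>Both sides are derivatives at t = 0 of Phi(\<gamma>(Z + t v v^t))[u], computed once
  along the image line and once through the law; uniqueness of derivatives equates them.\<close>

lemma coeff_dderiv_transform:
  fixes \<gamma> :: "int^('g::finite+'g)^('g+'g)" and Z :: "complex^'g^'g" and u :: "complex^'g"
  defines "v \<equiv> transpose (autom_J \<gamma> Z) *v u"
  defines "\<kappa> \<equiv> cdot u (blkC \<gamma> *v v)"
  assumes \<gamma>: "\<gamma> \<in> Sp" and V: "poly_regular m c \<Phi> V" and W: "dense_open_H W" "W \<subseteq> V"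
    and law: "\<And>Z u. Z \<in> W \<Longrightarrow> \<Phi> (act \<gamma> Z) u
      = (det (autom_J \<gamma> Z) powi k) *s \<Phi> Z (transpose (autom_J \<gamma> Z) *v u)"
    and Z: "Z \<in> W" and X: "act \<gamma> Z \<in> V"
  shows "coeff_dderiv m c (act \<gamma> Z) u (outer u u) l = det (autom_J \<gamma> Z) powi k *
    ((of_int k + of_nat m) * \<kappa> * \<Phi> Z v $ l + coeff_dderiv m c Z v (outer v v) l)"
proof -
  let ?J = "autom_J \<gamma> Z" and ?X = "act \<gamma> Z"
  let ?f = "\<lambda>t. \<Phi> (Z + cscale t (outer v v)) v $ l" and ?g = "\<lambda>s. \<Phi> (?X + cscale s (outer u u)) u $ l"
  have ZH: "Z \<in> siegel_H" using Z W by (auto simp: dense_open_H_def)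
  have f: "(?f has_field_derivative coeff_dderiv m c Z v (outer v v) l) (at 0)"
    using has_field_derivative_form[OF V] Z W(2) by (auto simp: transpose_outer)
  have g: "(?g has_field_derivative coeff_dderiv m c ?X u (outer u u) l) (at 0)"
    using has_field_derivative_form[OF V X] by (simp add: transpose_outer)
  \<comment> \<open>The reparametrisation fixes 0 with derivative 1, so passing from s to t leaves
    the derivative at 0 unchanged.\<close>
  have s: "((\<lambda>t. t / (1 + t * \<kappa>)) has_field_derivative 1) (at 0)"
    by (auto intro!: derivative_eq_intros)
  have lhs: "((\<lambda>t. ?g (t / (1 + t * \<kappa>))) has_field_derivative coeff_dderiv m c ?X u (outer u u) l) (at 0)"
    using DERIV_chain2[of ?g _ "\<lambda>t. t / (1 + t * \<kappa>)" 0 1 UNIV] g s by simp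
  \<comment> \<open>Exponent k comes from the determinant and m from homogeneity in the vector
    argument; the sum is an integer power since k may be negative.\<close>
  have pw: "((\<lambda>t. (1 + t * \<kappa>) powi (k + int m)) has_field_derivative (of_int k + of_nat m) * \<kappa>) (at 0)"
    by (auto intro!: derivative_eq_intros)
  have rhs: "((\<lambda>t. det ?J powi k * ((1 + t * \<kappa>) powi (k + int m) * ?f t)) has_field_derivative
      det ?J powi k * ((of_int k + of_nat m) * \<kappa> * \<Phi> Z v $ l + coeff_dderiv m c Z v (outer v v) l)) (at 0)"
    using DERIV_cmult[OF DERIV_mult[OF pw f], of "det ?J powi k"] by (simp add: algebra_simps)
  obtain T where T: "open T" "0 \<in> T" "\<forall>t\<in>T. Z + cscale t (outer v v) \<in> W"
    using dense_open_H_eventually_line[OF W(1) Z] transpose_outer by blast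
  have "((\<lambda>t. det ?J powi k * ((1 + t * \<kappa>) powi (k + int m) * ?f t)) has_field_derivative
      coeff_dderiv m c ?X u (outer u u) l) (at 0)"
    using lhs
  proof (rule has_field_derivative_transform_within_open)
    \<comment> \<open>Nonvanishing of 1 + t \<kappa> is required by \<open>act_rank_one\<close> and
      for adding the exponents k and m.\<close>
    show "open (T \<inter> {t. 1 + t * \<kappa> \<noteq> 0})"
      by (intro open_Int T open_Collect_neq continuous_intros)
    fix t assume "t \<in> T \<inter> {t. 1 + t * \<kappa> \<noteq> 0}"
    then have t: "Z + cscale t (outer v v) \<in> W" "1 + t * \<kappa> \<noteq> 0" using T by auto
    have "\<Phi> (?X + cscale (t / (1 + t * \<kappa>)) (outer u u)) u
        = \<Phi> (act \<gamma> (Z + cscale t (outer v v))) u"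
      using act_rank_one[OF \<gamma> ZH, of t u] t(2) unfolding \<kappa>_def v_def by simp
    also have "\<dots> = ((1 + t * \<kappa>) * det ?J) powi k *s \<Phi> (Z + cscale t (outer v v)) ((1 + t * \<kappa>) *s v)"
      using law[OF t(1), of u] det_autom_J_rank_one[of \<gamma> Z t u] transpose_autom_J_rank_one[of \<gamma> Z t u]
      unfolding \<kappa>_def v_def by simp
    also have "\<Phi> (Z + cscale t (outer v v)) ((1 + t * \<kappa>) *s v)
        = (1 + t * \<kappa>) ^ m *s \<Phi> (Z + cscale t (outer v v)) v"
    proof -
      have "\<Phi> (Z + cscale t (outer v v)) = polyev m (c (Z + cscale t (outer v v)))"
        using V W(2) t(1) unfolding poly_regular_def by blast
      then show ?thesis by (simp only: polyev_scale)
    qed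
    finally show "?g (t / (1 + t * \<kappa>)) = det ?J powi k * ((1 + t * \<kappa>) powi (k + int m) * ?f t)"
      using t(2) by (simp add: power_int_mult_distrib power_int_add mult_ac)
  qed (use T in simp)
  from DERIV_unique[OF this rhs] show ?thesis .
qed

subsection \<open>Covariance of the corrected derivative\<close>

lemma D_A_form:
  assumes "poly_regular m c \<Phi> V" "Z \<in> V"
  shows "D_A A e k m \<Phi> Z u $ l = coeff_dderiv m c Z u (outer u u) l / (2 * pi * \<i>)
    - (of_int k + of_nat m) / (2 * e) * cdot u (A Z *v u) * \<Phi> Z u $ l"
  unfolding D_A_def quadratic_form_eq by (simp add: D_raw_eq_outer[OF assms])

definition D_A_coeff where
  "D_A_coeff A e k m c Z \<beta> = (\<Sum>x\<in>{x\<in>raise_dom m. raise_exp x = \<beta>}. case x of (i, j, \<alpha>) \<Rightarrow>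
    (\<chi> l. 1 / (2 * pi * \<i>) * dderiv (\<lambda>W. c W \<alpha> $ l) Z (dirmat i j)
      - (of_int k + of_nat m) / (2 * e) * (A Z $ i $ j * c Z \<alpha> $ l)))"

lemma D_A_polyev:
  assumes V: "poly_regular m c \<Phi> V" and Z: "Z \<in> V"
  shows "D_A A e k m \<Phi> Z u = polyev (m + 2) (D_A_coeff A e k m c Z) u"
proof -
  let ?K = "(of_int k + of_nat m) / (2 * e)"
  have "polyev (m + 2) (D_A_coeff A e k m c Z) u $ l = D_A A e k m \<Phi> Z u $ l" for l
  proof -
    have "polyev (m + 2) (D_A_coeff A e k m c Z) u $ l = (\<Sum>i\<in>UNIV. \<Sum>j\<in>UNIV. \<Sum>\<alpha>\<in>monoms m.
        u$i * u$j * (1 / (2 * pi * \<i>) * (monom_eval \<alpha> u * dderiv (\<lambda>W. c W \<alpha> $ l) Z (dirmat i j)))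
        - ?K * (u$i * A Z $ i $ j * u$j) * (monom_eval \<alpha> u * c Z \<alpha> $ l))"
      unfolding D_A_coeff_def polyev_raise sum.cartesian_product[symmetric]
      by (intro sum.cong refl) (simp add: algebra_simps)
    also have "\<dots> = (\<Sum>i\<in>UNIV. \<Sum>j\<in>UNIV.
        u$i * u$j * (1 / (2 * pi * \<i>) * coeff_dderiv m c Z u (dirmat i j) l)
        - ?K * (u$i * A Z $ i $ j * u$j) * \<Phi> Z u $ l)"
      using V Z unfolding sum_subtractf sum_distrib_left[symmetric] coeff_dderiv_def
      by (simp add: poly_regular_def polyev_component)
    also have "\<dots> = D_raw \<Phi> Z u $ l - ?K * (\<Sum>i\<in>UNIV. \<Sum>j\<in>UNIV. u$i * A Z $ i $ j * u$j) * \<Phi> Z u $ l"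
      unfolding sum_subtractf D_raw_form[OF V Z] by (simp only: sum_distrib_left sum_distrib_right)
    finally show ?thesis by (simp add: D_A_def)
  qed
  then show ?thesis by (simp add: vec_eq_iff)
qed

lemma mero_on_H_D_A_coeff:
  fixes c :: "complex^'g::finite^'g \<Rightarrow> ('g \<Rightarrow> nat) \<Rightarrow> complex^'n"
  assumes A: "\<And>i j. mero_on_H (\<lambda>Z. A Z $ i $ j)"
    and c: "\<And>\<alpha> l. \<alpha> \<in> monoms m \<Longrightarrow> mero_on_H (\<lambda>Z. c Z \<alpha> $ l)"
  shows "mero_on_H (\<lambda>Z. D_A_coeff A e k m c Z \<beta> $ l)"
proof -
  let ?I = "{x\<in>raise_dom m. raise_exp x = \<beta>} :: ('g \<times> 'g \<times> ('g \<Rightarrow> nat)) set"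
  let ?K = "(of_int k + of_nat m) / (2 * e)"
  let ?t = "\<lambda>x Z. 1 / (2 * pi * \<i>) * dderiv (\<lambda>W. c W (snd (snd x)) $ l) Z (dirmat (fst x) (fst (snd x)))
      + (- ?K) * (A Z $ fst x $ fst (snd x) * c Z (snd (snd x)) $ l)"
  have eq: "D_A_coeff A e k m c Z \<beta> $ l = (\<Sum>x\<in>?I. ?t x Z)" for Z
    by (simp add: D_A_coeff_def sum_component split_beta)
  have "mero_on_H (?t x)" if "x \<in> ?I" for x
    using that by (intro mero_on_H_add mero_on_H_cmult mero_on_H_mult mero_on_H_dderiv A c
        transpose_dirmat) auto
  moreover have "finite ?I" by (simp add: finite_monoms)
  \<comment> \<open>If \<open>\<beta>\<close> is not of total degree m + 2 the fibre is empty; the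
    zero function is obtained as 0 times an entry of \<open>A\<close>.\<close>
  moreover have "mero_on_H (\<lambda>Z :: complex^'g^'g. 0)"
    using mero_on_H_cmult[OF A, of 0] by simp
  moreover have "mero_on_H (\<lambda>Z. \<Sum>x\<in>?I. ?t x Z)" if "?I = {}"
    unfolding that sum.empty by fact
  ultimately show ?thesis
    unfolding eq using mero_on_H_sum[of ?I ?t] by blast
qed

lemma D_A_transform:
  fixes \<gamma> :: "int^('g::finite+'g)^('g+'g)" and Z :: "complex^'g^'g" and u :: "complex^'g"
  assumes \<gamma>: "\<gamma> \<in> Sp" and "e \<noteq> 0"
    and V: "poly_regular m c \<Phi> V" and W: "dense_open_H W" "W \<subseteq> V"
    and law: "\<And>Z u. Z \<in> W \<Longrightarrow> \<Phi> (act \<gamma> Z) u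
      = (det (autom_J \<gamma> Z) powi k) *s \<Phi> Z (transpose (autom_J \<gamma> Z) *v u)"
    and A: "A (act \<gamma> Z) = autom_J \<gamma> Z ** A Z ** transpose (autom_J \<gamma> Z)
      + cscale (2 * e / (2 * pi * \<i>)) (autom_J \<gamma> Z ** transpose (blkC \<gamma>))"
    and Z: "Z \<in> W" and X: "act \<gamma> Z \<in> V"
  shows "D_A A e k m \<Phi> (act \<gamma> Z) u
    = (det (autom_J \<gamma> Z) powi k) *s D_A A e k m \<Phi> Z (transpose (autom_J \<gamma> Z) *v u)"
proof -
  let ?J = "autom_J \<gamma> Z"
  define v where "v = transpose ?J *v u"
  define \<kappa> where "\<kappa> = cdot u (blkC \<gamma> *v v)"
  let ?d = "det ?J powi k" and ?K = "(of_int k + of_nat m) / (2 * e) :: complex"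
  have cs: "cscale a M *v w = a *s (M *v w)" for a and M :: "complex^'g^'g" and w
    by (simp add: cscale_def matrix_vector_mult_def vec_eq_iff sum_distrib_left mult.assoc)
  have J: "cdot u (?J *v w) = cdot v w" for w
    unfolding v_def using cdot_matrix[of "?J" w u] by (simp only: cdot_commute)
  have "cdot u ((?J ** A Z ** transpose ?J) *v u) = cdot v (A Z *v v)"
    unfolding matrix_vector_mul_assoc[symmetric] v_def[symmetric] by (rule J)
  \<comment> \<open>u^t J C^t u = v^t C^t u = u^t C v, the same scalar that governs the rank-one
    line.\<close>
  moreover have "cdot u ((?J ** transpose (blkC \<gamma>)) *v u) = \<kappa>"
    unfolding matrix_vector_mul_assoc[symmetric] J \<kappa>_def
    by (simp only: cdot_matrix[symmetric] cdot_commute)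
  ultimately have q: "cdot u (A (act \<gamma> Z) *v u) = cdot v (A Z *v v) + 2 * e / (2 * pi * \<i>) * \<kappa>"
    unfolding A matrix_vector_mult_add_rdistrib cs cdot_add_right cdot_scale by simp
  \<comment> \<open>The inhomogeneous term of \<open>A\<close> contributes exactly the defect of
    \<open>coeff_dderiv_transform\<close> divided by 2 pi i, with opposite sign in
    \<open>D_A\<close>.\<close>
  have K: "?K * (2 * e / (2 * pi * \<i>) * \<kappa>) = (of_int k + of_nat m) * \<kappa> / (2 * pi * \<i>)"
    using \<open>e \<noteq> 0\<close> by simp
  have "D_A A e k m \<Phi> (act \<gamma> Z) u $ l = ?d * D_A A e k m \<Phi> Z v $ l" for l
  proof -
    have \<Phi>X: "\<Phi> (act \<gamma> Z) u $ l = ?d * \<Phi> Z v $ l"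
      using law[OF Z, of u] by (simp add: v_def)
    have "D_A A e k m \<Phi> (act \<gamma> Z) u $ l
        = ?d * ((of_int k + of_nat m) * \<kappa> * \<Phi> Z v $ l + coeff_dderiv m c Z v (outer v v) l) / (2 * pi * \<i>)
          - (?K * cdot v (A Z *v v) + ?K * (2 * e / (2 * pi * \<i>) * \<kappa>)) * (?d * \<Phi> Z v $ l)"
      using coeff_dderiv_transform[OF \<gamma> V W law Z X, of u l]
      unfolding D_A_form[OF V X] q \<Phi>X distrib_left[symmetric] v_def[symmetric] \<kappa>_def[symmetric]
      by (simp only: mult.assoc)
    also have "\<dots> = ?d * (coeff_dderiv m c Z v (outer v v) l / (2 * pi * \<i>)
          - ?K * cdot v (A Z *v v) * \<Phi> Z v $ l)"
      unfolding K by (simp add: algebra_simps add_divide_distrib)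
    also have "\<dots> = ?d * D_A A e k m \<Phi> Z v $ l"
      using Z W(2) by (simp add: D_A_form[OF V] subset_iff)
    finally show ?thesis .
  qed
  then show ?thesis by (simp add: vec_eq_iff v_def)
qed

theorem mainTheorem17:
  fixes \<Gamma> :: "(int^('g::finite+'g)^('g+'g)) set"
    and mul :: "complex^'n::finite \<Rightarrow> complex^'n \<Rightarrow> complex^'n"
    and e :: complex
    and A :: "complex^'g^'g \<Rightarrow> complex^'g^'g"
    and k :: int and m :: nat
    and \<Phi> :: "complex^'g^'g \<Rightarrow> complex^'g \<Rightarrow> complex^'n"
  assumes "congruence_subgroup \<Gamma>"
    and "fd_complex_algebra mul"
    and "e \<noteq> 0"
    and "\<forall>i j. mero_on_H (\<lambda>Z. A Z $ i $ j)"
    and "\<forall>Z\<in>siegel_H. transpose (A Z) = A Z"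
    and "\<forall>\<gamma>\<in>\<Gamma>. ae_eq_H (\<lambda>Z. A (act \<gamma> Z))
           (\<lambda>Z. autom_J \<gamma> Z ** A Z ** transpose (autom_J \<gamma> Z)
                + cscale (2 * e / (2 * pi * \<i>)) (autom_J \<gamma> Z ** transpose (blkC \<gamma>)))"
    and "mform \<Gamma> k m \<Phi>"
  shows "mform \<Gamma> k (m + 2) (D_A A e k m \<Phi>)"
proof -
  obtain c where c: "\<forall>\<alpha>\<in>monoms m. \<forall>j. mero_on_H (\<lambda>Z. c Z \<alpha> $ j)"
    and ae: "ae_eq_H \<Phi> (\<lambda>Z. polyev m (c Z))"
    and law: "\<forall>\<gamma>\<in>\<Gamma>. ae_eq_H (\<lambda>Z. \<Phi> (act \<gamma> Z))
        (\<lambda>Z u. (det (autom_J \<gamma> Z) powi k) *s \<Phi> Z (transpose (autom_J \<gamma> Z) *v u))"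
    using assms(7) unfolding mform_def by blast
  obtain V where V: "poly_regular m c \<Phi> V"
    using poly_regular_exists[OF _ ae] c by blast
  then have V_dense: "dense_open_H V" by (simp add: poly_regular_def)
  have "ae_eq_H (D_A A e k m \<Phi>) (\<lambda>Z. polyev (m + 2) (D_A_coeff A e k m c Z))"
    unfolding ae_eq_H_iff using V_dense D_A_polyev[OF V] by blast
  moreover have "\<forall>\<beta>\<in>monoms (m + 2). \<forall>l. mero_on_H (\<lambda>Z. D_A_coeff A e k m c Z \<beta> $ l)"
    using mero_on_H_D_A_coeff[of A m c] assms(4) c by blast
  moreover have "ae_eq_H (\<lambda>Z. D_A A e k m \<Phi> (act \<gamma> Z))
      (\<lambda>Z u. (det (autom_J \<gamma> Z) powi k) *s D_A A e k m \<Phi> Z (transpose (autom_J \<gamma> Z) *v u))"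
    if \<gamma>: "\<gamma> \<in> \<Gamma>" for \<gamma>
  proof -
    obtain \<gamma>' where \<gamma>': "\<gamma>' \<in> \<Gamma>" "\<gamma> ** \<gamma>' = mat 1" "\<gamma>' ** \<gamma> = mat 1"
      using assms(1) \<gamma> unfolding congruence_subgroup_def by blast
    have Sp: "\<gamma> \<in> Sp" "\<gamma>' \<in> Sp"
      using assms(1) \<gamma> \<gamma>'(1) by (auto simp: congruence_subgroup_def)
    obtain V1 where V1: "dense_open_H V1" "\<forall>Z\<in>V1. \<Phi> (act \<gamma> Z)
        = (\<lambda>u. (det (autom_J \<gamma> Z) powi k) *s \<Phi> Z (transpose (autom_J \<gamma> Z) *v u))"
      using law \<gamma> unfolding ae_eq_H_iff by blast
    obtain V2 where V2: "dense_open_H V2" "\<forall>Z\<in>V2. A (act \<gamma> Z)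
        = autom_J \<gamma> Z ** A Z ** transpose (autom_J \<gamma> Z)
          + cscale (2 * e / (2 * pi * \<i>)) (autom_J \<gamma> Z ** transpose (blkC \<gamma>))"
      using assms(6) \<gamma> unfolding ae_eq_H_iff by blast
    \<comment> \<open>Differentiating at the image point requires \<open>\<Phi>\<close> to be
      regular there as well.\<close>
    let ?V3 = "{Z\<in>siegel_H. act \<gamma> Z \<in> V}"
    have "open (sym_part -` (siegel_H :: (complex^'g^'g) set))"
      using rel_open_siegel_H assms(4) by blast
    then have V3: "dense_open_H ?V3"
      by (rule dense_open_H_act_vimage[OF Sp \<gamma>'(2,3) _ V_dense])
    \<comment> \<open>The law of \<open>\<Phi>\<close> is differentiated, so it must hold on a
      relatively open set inside \<open>V\<close>; the law of \<open>A\<close> enters only at the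
      point Z, and \<open>V2\<close> is intersected afterwards.\<close>
    let ?W = "V \<inter> V1"
    have W: "dense_open_H ?W" "?W \<subseteq> V" using dense_open_H_Int[OF V_dense V1(1)] by auto
    have "dense_open_H (?W \<inter> (V2 \<inter> ?V3))"
      by (intro dense_open_H_Int W V2 V3)
    moreover have "D_A A e k m \<Phi> (act \<gamma> Z)
        = (\<lambda>u. (det (autom_J \<gamma> Z) powi k) *s D_A A e k m \<Phi> Z (transpose (autom_J \<gamma> Z) *v u))"
      if Z: "Z \<in> ?W \<inter> (V2 \<inter> ?V3)" for Z
    proof
      fix u
      show "D_A A e k m \<Phi> (act \<gamma> Z) u
          = (det (autom_J \<gamma> Z) powi k) *s D_A A e k m \<Phi> Z (transpose (autom_J \<gamma> Z) *v u)"
        by (rule D_A_transform[OF Sp(1) assms(3) V W]) (use Z V1(2) V2(2) in auto)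
    qed
    ultimately show ?thesis unfolding ae_eq_H_iff by blast
  qed
  ultimately show ?thesis unfolding mform_def by blast
qed

end
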